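(* Consider the adiabatic model $H(z)=H_0+zH_f$ on $n$ qubits, with $H_0=-|\phi\rangle\langle\phi|$, $|\phi\rangle=\frac1{\sqrt N}\sum_s|s\rangle$, $H_f=\sum_s E(s)|s\rangle\langle s|$ and spectral gap $g(z)$. There exists a schedule $z:[0,1]\to[0,z_f]$, solution to the boundary-value problem $\dot z(\beta)=c\,g(z(\beta))^2$, $z(0)=0$, $z(1)=z_f$ (where $c=\int_0^{z_f}\frac{dz}{g(z)^2}$ is the normalization constant), that achieves a time complexity $$T=O\!\left(\sqrt{N/N_0}\right),$$ where factors polynomial in $n$ are omitted in the $O$-notation.
   Context: Let $n\ge1$, $N=2^n$, and let $s$ range over the $N$ assignments of $n$ binary variables; $\{|s\rangle\}$ is the computational basis of $\mathbb C^N$. The cost function $E(s)$ takes integer values in $\{0,\dots,m\}$ with $m=\mathrm{poly}(n)$. $N_E$ is the number of $s$ with $E(s)=E$, and $n_E=N_E/N$. It is assumed that $N_0>0$ (and $N_0<N$, so that the gap below is defined). Put $Z_p=\sum_{E=1}^m n_E/E^p$. Gap: for $z>0$ let $X(\lambda)=1+\frac1N\sum_{E=0}^m\frac{N_E}{\lambda-zE}$. Its two smallest roots satisfy $\lambda_0(z)<0<\lambda_1(z)$, and $g(z)=\lambda_1(z)-\lambda_0(z)$. This is the gap of $H(z)$ restricted to the invariant subspace spanned by the uniform superpositions of basis states of equal cost, which contains $|\phi\rangle$. Stopping point: $z_f=z_*+\Delta$, with $z_*$ the location of the minimum of $g$ (one has $z_*=Z_1+O(n_0)$) and $\Delta=\sqrt{\frac{4N_0Z_2}{N\delta}}$,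 where $\delta\ll1$ is a constant independent of $n$. Time complexity: given a schedule $z(\beta)$, $\beta=t/T\in[0,1]$, with $t$ the time and $T$ the total evolution time, write $H(\beta)=H(z(\beta))$ and $g(\beta)=g(z(\beta))$, let dots denote $d/d\beta$, and let $\|\cdot\|$ be the operator norm. The adiabatic theorem guarantees an error less than $\varepsilon$ between the evolved state and the final ground state once $$T\ge\frac C\varepsilon,\qquad C=2\max_\beta\frac{\|\dot H(\beta)\|}{g(\beta)^2}+\int_0^1\left(\frac{\|\ddot H\|}{g^2}+\frac{7\|\dot H\|^2}{g^3}\right)d\beta .$$ The time complexity achieved by the schedule is the evolution time $T=C/\varepsilon$ given by this criterion, for a fixed error $\varepsilon$ independent of $n$. Asymptotics are for $n\to\infty$. *)

theory Defs
  imports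
    "HOL-Analysis.Analysis"
    "HOL-Library.Landau_Symbols"
    "Jordan_Normal_Form.Char_Poly"
    "Jordan_Normal_Form.VS_Connect"
begin

unbundle no vec_syntax
hide_type (open) Finite_Cartesian_Product.vec
hide_const (open) Finite_Cartesian_Product.vec Finite_Cartesian_Product.mat

text \<open>An assignment of \<open>n\<close> binary variables is identified with the number \<open>s < 2 ^ n\<close> whose binary
  digits are the values of the variables; \<open>unit_vec (2 ^ n) s\<close> is then the basis state of \<open>s\<close>. An
  instance of size \<open>n\<close> is a cost function \<open>E :: nat \<Rightarrow> nat\<close>, of which only the values at
  arguments below \<open>2 ^ n\<close> are used.\<close>

definition level_count :: "nat \<Rightarrow> (nat \<Rightarrow> nat) \<Rightarrow> nat \<Rightarrow> nat" where
  "level_count n E e = card {s. s < 2 ^ n \<and> E s = e}"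

definition level_density :: "nat \<Rightarrow> (nat \<Rightarrow> nat) \<Rightarrow> nat \<Rightarrow> real" where
  "level_density n E e = real (level_count n E e) / 2 ^ n"

definition Z_moment :: "nat \<Rightarrow> nat \<Rightarrow> (nat \<Rightarrow> nat) \<Rightarrow> nat \<Rightarrow> real" where
  "Z_moment n m E p = (\<Sum>e = 1..m. level_density n E e / real e ^ p)"

definition uniform_state :: "nat \<Rightarrow> complex vec" where
  "uniform_state n = vec (2 ^ n) (\<lambda>_. complex_of_real (1 / sqrt (2 ^ n)))"

definition ket_bra :: "complex vec \<Rightarrow> complex vec \<Rightarrow> complex mat" where
  "ket_bra v w = mat (dim_vec v) (dim_vec w) (\<lambda>(i, j). v $ i * cnj (w $ j))"

definition initial_hamiltonian :: "nat \<Rightarrow> complex mat" where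
  "initial_hamiltonian n = - ket_bra (uniform_state n) (uniform_state n)"

definition final_hamiltonian :: "nat \<Rightarrow> (nat \<Rightarrow> nat) \<Rightarrow> complex mat" where
  "final_hamiltonian n E = mat_diag (2 ^ n) (\<lambda>s. of_nat (E s))"

definition hamiltonian :: "nat \<Rightarrow> (nat \<Rightarrow> nat) \<Rightarrow> real \<Rightarrow> complex mat" where
  "hamiltonian n E z =
     initial_hamiltonian n + complex_of_real z \<cdot>\<^sub>m final_hamiltonian n E"

definition level_state :: "nat \<Rightarrow> (nat \<Rightarrow> nat) \<Rightarrow> nat \<Rightarrow> complex vec" where
  "level_state n E e =
     vec (2 ^ n) (\<lambda>s. if E s = e then complex_of_real (1 / sqrt (real (level_count n E e))) else 0)"

definition symmetric_subspace :: "nat \<Rightarrow> (nat \<Rightarrow> nat) \<Rightarrow> complex vec set" where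
  "symmetric_subspace n E =
     LinearCombinations.module.span class_ring (module_vec TYPE(complex) (2 ^ n))
       (level_state n E ` E ` {..<2 ^ n})"

definition restricted_spectrum :: "nat \<Rightarrow> (nat \<Rightarrow> nat) \<Rightarrow> real \<Rightarrow> real set" where
  "restricted_spectrum n E z =
     {l. \<exists>v \<in> symmetric_subspace n E. eigenvector (hamiltonian n E z) v (complex_of_real l)}"

definition two_smallest_gap :: "real set \<Rightarrow> real" where
  "two_smallest_gap S = Min (S - {Min S}) - Min S"

text \<open>The spectral gap is defined for all \<open>z \<ge> 0\<close> as a gap of the restricted operator; for \<open>z > 0\<close> it
  is the distance of the two smallest roots of the secular function \<open>X\<close>, as proved in
  \<open>gap_eq_secular_roots\<close>, and \<open>gap n E 0 = 1\<close> by \<open>gap_at_zero\<close>. Multiplicities are not counted; they are all one for \<open>z > 0\<close>, and at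
  \<open>z = 0\<close> the lowest eigenvalue is simple.\<close>

definition gap :: "nat \<Rightarrow> (nat \<Rightarrow> nat) \<Rightarrow> real \<Rightarrow> real" where
  "gap n E z = two_smallest_gap (restricted_spectrum n E z)"

definition stopping_width :: "nat \<Rightarrow> nat \<Rightarrow> (nat \<Rightarrow> nat) \<Rightarrow> real \<Rightarrow> real" where
  "stopping_width n m E \<delta> =
     sqrt (4 * real (level_count n E 0) * Z_moment n m E 2 / (2 ^ n * \<delta>))"

definition vec_norm2 :: "complex vec \<Rightarrow> real" where
  "vec_norm2 v = L2_set (\<lambda>i. cmod (v $ i)) {..<dim_vec v}"

definition mat_op_norm :: "complex mat \<Rightarrow> real" where
  "mat_op_norm A = (SUP v \<in> {v \<in> carrier_vec (dim_col A). vec_norm2 v \<le> 1}. vec_norm2 (A *\<^sub>v v))"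

definition has_mat_derivative ::
    "nat \<Rightarrow> (real \<Rightarrow> complex mat) \<Rightarrow> complex mat \<Rightarrow> real filter \<Rightarrow> bool" where
  "has_mat_derivative d A A' F \<longleftrightarrow> A' \<in> carrier_mat d d \<and>
     (\<forall>i < d. \<forall>j < d. ((\<lambda>x. A x $$ (i, j)) has_vector_derivative A' $$ (i, j)) F)"

text \<open>\<open>T\<close> is the evolution time \<open>C / \<epsilon>\<close> given by the adiabatic criterion. The relational form makes the
  existence of the two derivatives of the Hamiltonian, of the maximum (\<open>M\<close>) and of the integral
  (\<open>I\<close>) part of the assertion.\<close>

definition adiabatic_time ::
    "nat \<Rightarrow> (nat \<Rightarrow> nat) \<Rightarrow> real \<Rightarrow> (real \<Rightarrow> real) \<Rightarrow> real \<Rightarrow> bool" where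
  "adiabatic_time n E \<epsilon> z T \<longleftrightarrow>
     (\<exists>H' H'' M I.
        (\<forall>\<beta> \<in> {0..1}. has_mat_derivative (2 ^ n) (\<lambda>b. hamiltonian n E (z b)) (H' \<beta>)
                        (at \<beta> within {0..1})) \<and>
        (\<forall>\<beta> \<in> {0..1}. has_mat_derivative (2 ^ n) H' (H'' \<beta>) (at \<beta> within {0..1})) \<and>
        (\<exists>\<beta> \<in> {0..1}. M = mat_op_norm (H' \<beta>) / gap n E (z \<beta>) ^ 2) \<and>
        (\<forall>\<beta> \<in> {0..1}. mat_op_norm (H' \<beta>) / gap n E (z \<beta>) ^ 2 \<le> M) \<and>
        ((\<lambda>\<beta>. mat_op_norm (H'' \<beta>) / gap n E (z \<beta>) ^ 2
              + 7 * mat_op_norm (H' \<beta>) ^ 2 / gap n E (z \<beta>) ^ 3) has_integral I) {0..1} \<and>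
        T = (2 * M + I) / \<epsilon>)"

definition gap_schedule ::
    "nat \<Rightarrow> (nat \<Rightarrow> nat) \<Rightarrow> real \<Rightarrow> (real \<Rightarrow> real) \<Rightarrow> bool" where
  "gap_schedule n E zf z \<longleftrightarrow>
     z ` {0..1} \<subseteq> {0..zf} \<and> z 0 = 0 \<and> z 1 = zf \<and>
     (\<lambda>x. 1 / gap n E x ^ 2) integrable_on {0..zf} \<and>
     (\<forall>\<beta> \<in> {0..1}. (z has_real_derivative
        integral {0..zf} (\<lambda>x. 1 / gap n E x ^ 2) * gap n E (z \<beta>) ^ 2) (at \<beta> within {0..1}))"

text \<open>The secular function. In HOL, division by zero yields zero, so its poles have to be excluded
  explicitly from the set of roots.\<close>

definition secular :: "nat \<Rightarrow> nat \<Rightarrow> (nat \<Rightarrow> nat) \<Rightarrow> real \<Rightarrow> real \<Rightarrow> real" where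
  "secular n m E z l =
     1 + 1 / 2 ^ n * (\<Sum>e = 0..m. real (level_count n E e) / (l - z * real e))"

definition secular_roots :: "nat \<Rightarrow> nat \<Rightarrow> (nat \<Rightarrow> nat) \<Rightarrow> real \<Rightarrow> real set" where
  "secular_roots n m E z =
     {l. secular n m E z l = 0 \<and> (\<forall>e \<le> m. level_count n E e > 0 \<longrightarrow> l \<noteq> z * real e)}"

lemma symmetric_subspace_eq:
  "symmetric_subspace n E =
     {v \<in> carrier_vec (2 ^ n). \<forall>s < 2 ^ n. \<forall>t < 2 ^ n. E s = E t \<longrightarrow> v $ s = v $ t}"
  (is "_ = ?V")
proof -
  define N :: nat where "N = 2 ^ n"
  interpret vec_space "TYPE(complex)" N .
  define W where "W = level_state n E ` E ` {..<N}"
  have W: "W \<subseteq> carrier_vec N" by (auto simp: W_def level_state_def N_def)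
  have finW: "finite W" by (simp add: W_def)
  have pos: "level_count n E (E s) > 0" if "s < N" for s
    using that unfolding level_count_def N_def by (subst card_gt_0_iff) auto
  have "span W = ?V"
  proof (intro equalityI subsetI)
    fix v assume "v \<in> span W"
    from in_spanE[OF this] obtain a A where v: "v = lincomb a A" and A: "finite A" "A \<subseteq> W"
      by blast
    have AC: "A \<subseteq> carrier_vec N" using A W by auto
    have inv: "x $ s = x $ t" if "x \<in> A" "s < N" "t < N" "E s = E t" for x s t
      using that A by (auto simp: W_def level_state_def N_def)
    have "v $ s = v $ t" if st: "s < N" "t < N" "E s = E t" for s t
    proof -
      have "(\<Sum>x\<in>A. a x * x $ s) = (\<Sum>x\<in>A. a x * x $ t)"
        by (rule sum.cong[OF refl]) (metis inv st)
      then show ?thesis using st by (simp only: v lincomb_index[OF _ AC])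
    qed
    moreover have "v \<in> carrier_vec N" using A AC v lincomb_closed by auto
    ultimately show "v \<in> ?V" unfolding N_def by blast
  next
    fix v assume v: "v \<in> ?V"
    define a where "a x = (let s = SOME s. s < N \<and> x $ s \<noteq> 0 in v $ s / x $ s)" for x :: "complex vec"
    have *: "a (level_state n E (E s)) * level_state n E (E s) $ s = v $ s" if s: "s < N" for s
    proof -
      let ?x = "level_state n E (E s)"
      define s0 where "s0 = (SOME s. s < N \<and> ?x $ s \<noteq> 0)"
      have nz: "?x $ s \<noteq> 0" using s pos[OF s] by (simp add: level_state_def N_def)
      have s0: "s0 < N \<and> ?x $ s0 \<noteq> 0"
        unfolding s0_def by (rule someI[of _ s]) (use s nz in auto)
      then have Es: "E s0 = E s" by (auto simp: level_state_def N_def split: if_splits)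
      then have "?x $ s0 = ?x $ s" using s0 s by (simp add: level_state_def N_def)
      moreover have "v $ s0 = v $ s" using v s0 s Es unfolding N_def by blast
      ultimately show ?thesis using nz by (simp add: a_def Let_def s0_def[symmetric])
    qed
    have "v = lincomb a W"
    proof (rule eq_vecI)
      have d: "dim_vec (lincomb a W) = N" using lincomb_dim[OF finW W] .
      then show "dim_vec v = dim_vec (lincomb a W)" using v unfolding N_def by simp
      fix s assume "s < dim_vec (lincomb a W)"
      then have s: "s < N" using d by simp
      have "lincomb a W $ s = (\<Sum>x\<in>W. a x * x $ s)" by (rule lincomb_index[OF s W])
      also have "\<dots> = (\<Sum>x\<in>{level_state n E (E s)}. a x * x $ s)"
      proof (rule sum.mono_neutral_right)
        show "\<forall>x \<in> W - {level_state n E (E s)}. a x * x $ s = 0"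
        proof
          fix x assume x: "x \<in> W - {level_state n E (E s)}"
          then obtain r where r: "x = level_state n E (E r)" by (auto simp: W_def)
          with x have "E r \<noteq> E s" by auto
          then have "x $ s = 0" using s by (simp add: r level_state_def N_def)
          then show "a x * x $ s = 0" by simp
        qed
      qed (use finW s in \<open>auto simp: W_def\<close>)
      finally show "v $ s = lincomb a W $ s" using *[OF s] by simp
    qed
    then show "v \<in> span W" using finW by (auto intro!: in_spanI)
  qed
  then show ?thesis by (simp add: symmetric_subspace_def W_def N_def)
qed

lemma hamiltonian_carrier: "hamiltonian n E z \<in> carrier_mat (2 ^ n) (2 ^ n)"
  by (simp add: hamiltonian_def initial_hamiltonian_def final_hamiltonian_def mat_diag_def)

lemma hamiltonian_index:
  assumes "s < 2 ^ n" "t < 2 ^ n"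
  shows "hamiltonian n E z $$ (s, t) =
     (if s = t then complex_of_real z * of_nat (E t) else 0) - 1 / 2 ^ n"
proof -
  have "complex_of_real (sqrt (2 ^ n)) * complex_of_real (sqrt (2 ^ n)) = 2 ^ n"
    by (simp flip: of_real_mult)
  then show ?thesis
    using assms by (simp add: hamiltonian_def initial_hamiltonian_def final_hamiltonian_def
      mat_diag_def ket_bra_def uniform_state_def)
qed

lemma hamiltonian_mult_vec:
  assumes "v \<in> carrier_vec (2 ^ n)" "s < 2 ^ n"
  shows "(hamiltonian n E z *\<^sub>v v) $ s =
     complex_of_real z * of_nat (E s) * v $ s - (\<Sum>t<2 ^ n. v $ t) / 2 ^ n"
proof -
  have "(hamiltonian n E z *\<^sub>v v) $ s = (\<Sum>t<2 ^ n. hamiltonian n E z $$ (s, t) * v $ t)"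
    using assms hamiltonian_carrier[of n E z] by (simp add: scalar_prod_def atLeast0LessThan)
  also have "\<dots> = (\<Sum>t<2 ^ n. (if s = t then complex_of_real z * of_nat (E t) * v $ t else 0)
      - v $ t / 2 ^ n)"
    by (rule sum.cong) (use assms in \<open>auto simp: hamiltonian_index left_diff_distrib\<close>)
  also have "\<dots> = complex_of_real z * of_nat (E s) * v $ s - (\<Sum>t<2 ^ n. v $ t) / 2 ^ n"
    using assms by (simp add: sum_subtractf sum_divide_distrib)
  finally show ?thesis .
qed

lemma sum_levels:
  fixes f :: "nat \<Rightarrow> 'a :: comm_semiring_1"
  assumes "\<And>s. s < 2 ^ n \<Longrightarrow> E s \<le> m"
  shows "(\<Sum>s<2 ^ n. f (E s)) = (\<Sum>e = 0..m. of_nat (level_count n E e) * f e)"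
proof -
  have "(\<Sum>s<2 ^ n. f (E s)) = (\<Sum>e\<in>{0..m}. \<Sum>s\<in>{s \<in> {..<2 ^ n}. E s = e}. f (E s))"
    by (rule sum.group[symmetric]) (use assms in auto)
  also have "\<dots> = (\<Sum>e = 0..m. of_nat (level_count n E e) * f e)"
    by (rule sum.cong) (auto simp: level_count_def)
  finally show ?thesis .
qed

lemma restricted_spectrum_eq_secular_roots:
  assumes z: "z > 0" and E: "\<And>s. s < 2 ^ n \<Longrightarrow> E s \<le> m"
  shows "restricted_spectrum n E z = secular_roots n m E z"
proof (intro equalityI subsetI)
  have pos: "level_count n E (E s) > 0" if "s < 2 ^ n" for s
    using that unfolding level_count_def by (subst card_gt_0_iff) auto
  have ex: "\<exists>s < 2 ^ n. E s = e" if "level_count n E e > 0" for e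
    using that unfolding level_count_def by (subst (asm) card_gt_0_iff) auto
  fix l
  have sec: "complex_of_real (secular n m E z l) =
      1 + (\<Sum>s<2 ^ n. 1 / (complex_of_real l - complex_of_real z * of_nat (E s))) / 2 ^ n"
    using sum_levels[where f = "\<lambda>e. 1 / (complex_of_real l - complex_of_real z * of_nat e)", OF E]
    by (simp add: secular_def)
  {
    assume "l \<in> restricted_spectrum n E z"
    then obtain v where v: "v \<in> carrier_vec (2 ^ n)"
      and sym: "\<And>s t. s < 2 ^ n \<Longrightarrow> t < 2 ^ n \<Longrightarrow> E s = E t \<Longrightarrow> v $ s = v $ t"
      and v0: "v \<noteq> 0\<^sub>v (2 ^ n)" and Hv: "hamiltonian n E z *\<^sub>v v = complex_of_real l \<cdot>\<^sub>v v"
      using hamiltonian_carrier[of n E z]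
      by (auto simp: restricted_spectrum_def symmetric_subspace_eq eigenvector_def)
    define \<sigma> where "\<sigma> = (\<Sum>t<2 ^ n. v $ t) / 2 ^ n"
    have eq: "(complex_of_real l - complex_of_real z * of_nat (E s)) * v $ s = - \<sigma>"
      if "s < 2 ^ n" for s
      using hamiltonian_mult_vec[OF v that, of E z] v that
      by (simp add: Hv \<sigma>_def algebra_simps)
    have \<sigma>: "\<sigma> \<noteq> 0"
    proof
      assume \<sigma>0: "\<sigma> = 0"
      obtain s where s: "s < 2 ^ n" "v $ s \<noteq> 0"
        using v0 v by (metis carrier_vecD eq_vecI index_zero_vec(1) zero_carrier_vec)
      have l: "complex_of_real l = complex_of_real z * of_nat (E s)" using eq[OF s(1)] s \<sigma>0 by simp
      have "v $ t = (if E t = E s then v $ s else 0)" if "t < 2 ^ n" for t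
        using eq[OF that] sym[OF that s(1)] l z \<sigma>0 by auto
      then have "(\<Sum>t<2 ^ n. v $ t) = (\<Sum>t<2 ^ n. if E t = E s then v $ s else 0)"
        by (intro sum.cong) auto
      also have "\<dots> = of_nat (level_count n E (E s)) * v $ s"
        by (simp add: sum.If_cases level_count_def Int_def)
      also have "\<dots> \<noteq> 0" using pos[OF s(1)] s by simp
      finally show False using \<sigma>0 by (simp add: \<sigma>_def)
    qed
    have ne: "complex_of_real l - complex_of_real z * of_nat (E s) \<noteq> 0" if "s < 2 ^ n" for s
      using eq[OF that] \<sigma> by auto
    have vs: "v $ s = - \<sigma> * (1 / (complex_of_real l - complex_of_real z * of_nat (E s)))"
      if "s < 2 ^ n" for s
      using eq[OF that] ne[OF that] by (simp add: field_simps)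
    have "\<sigma> = - \<sigma> * ((\<Sum>s<2 ^ n. 1 / (complex_of_real l - complex_of_real z * of_nat (E s))) / 2 ^ n)"
      unfolding times_divide_eq_right sum_distrib_left
      by (subst \<sigma>_def, rule arg_cong[where f = "\<lambda>x. x / _"], rule sum.cong) (use vs in auto)
    then have "\<sigma> * complex_of_real (secular n m E z l) = 0"
      unfolding sec by (simp add: eq_neg_iff_add_eq_0 distrib_left)
    then have "secular n m E z l = 0" using \<sigma> by simp
    moreover have "l \<noteq> z * real e" if "level_count n E e > 0" for e
    proof
      assume "l = z * real e"
      moreover obtain s where s: "s < 2 ^ n" "E s = e"
        using ex[OF \<open>level_count n E e > 0\<close>] by blast
      ultimately show False using ne[OF s(1)] by simp
    qed
    ultimately show "l \<in> secular_roots n m E z" by (auto simp: secular_roots_def)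
  next
    assume l: "l \<in> secular_roots n m E z"
    have ne: "complex_of_real l - complex_of_real z * of_nat (E s) \<noteq> 0" if "s < 2 ^ n" for s
    proof -
      have "l \<noteq> z * real (E s)" using l E[OF that] pos[OF that] by (auto simp: secular_roots_def)
      then have "complex_of_real l \<noteq> complex_of_real (z * real (E s))" 
        by (simp only: of_real_eq_iff) simp
      then show ?thesis by simp
    qed
    define v where "v = vec (2 ^ n) (\<lambda>s. 1 / (complex_of_real l - complex_of_real z * of_nat (E s)))"
    have vc: "v \<in> carrier_vec (2 ^ n)" by (simp add: v_def)
    have "0 = complex_of_real (secular n m E z l)" using l by (simp add: secular_roots_def)
    then have sum: "(\<Sum>s<2 ^ n. v $ s) / 2 ^ n = - 1"
      unfolding sec by (simp add: v_def eq_neg_iff_add_eq_0 add.commute)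
    have "hamiltonian n E z *\<^sub>v v = complex_of_real l \<cdot>\<^sub>v v"
    proof (rule eq_vecI)
      fix s assume "s < dim_vec (complex_of_real l \<cdot>\<^sub>v v)"
      then have s: "s < 2 ^ n" by (simp add: v_def)
      have "(complex_of_real l - complex_of_real z * of_nat (E s)) * v $ s = 1"
        using ne[OF s] s by (simp add: v_def)
      then show "(hamiltonian n E z *\<^sub>v v) $ s = (complex_of_real l \<cdot>\<^sub>v v) $ s"
        using hamiltonian_mult_vec[OF vc s, of E z] sum vc s by (simp add: algebra_simps)
    qed (use hamiltonian_carrier[of n E z] in \<open>simp add: v_def\<close>)
    moreover have "v \<noteq> 0\<^sub>v (2 ^ n)"
    proof
      assume "v = 0\<^sub>v (2 ^ n)"
      then have "(\<Sum>s<2 ^ n. v $ s) = 0" by simp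
      then show False using sum by simp
    qed
    moreover have "v \<in> symmetric_subspace n E" by (auto simp: symmetric_subspace_eq v_def)
    ultimately show "l \<in> restricted_spectrum n E z"
      using vc hamiltonian_carrier[of n E z]
      by (auto simp: restricted_spectrum_def eigenvector_def)
  }
qed

lemma gap_eq_secular_roots:
  assumes "z > 0" and "\<And>s. s < 2 ^ n \<Longrightarrow> E s \<le> m"
  shows "gap n E z = two_smallest_gap (secular_roots n m E z)"
  by (simp add: gap_def restricted_spectrum_eq_secular_roots[OF assms])

lemma gap_at_zero:
  assumes "s0 < 2 ^ n" "t0 < 2 ^ n" "E s0 \<noteq> E t0"
  shows "gap n E 0 = 1"
proof -
  have H: "hamiltonian n E 0 *\<^sub>v v = complex_of_real l \<cdot>\<^sub>v v \<longleftrightarrow>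
      (\<forall>s < 2 ^ n. - (\<Sum>t<2 ^ n. v $ t) / 2 ^ n = complex_of_real l * v $ s)"
    if v: "v \<in> carrier_vec (2 ^ n)" for v l
  proof -
    have "dim_vec (hamiltonian n E 0 *\<^sub>v v) = 2 ^ n"
      using hamiltonian_carrier[of n E 0] by simp
    then show ?thesis
      using v hamiltonian_mult_vec[OF v, of _ E 0] by (auto simp: vec_eq_iff)
  qed
  have mem: "l \<in> restricted_spectrum n E 0 \<longleftrightarrow> (\<exists>v \<in> carrier_vec (2 ^ n).
      (\<forall>s < 2 ^ n. \<forall>t < 2 ^ n. E s = E t \<longrightarrow> v $ s = v $ t) \<and> v \<noteq> 0\<^sub>v (2 ^ n) \<and>
      (\<forall>s < 2 ^ n. - (\<Sum>t<2 ^ n. v $ t) / 2 ^ n = complex_of_real l * v $ s))" for l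
    using hamiltonian_carrier[of n E 0] H[of _ l]
    unfolding restricted_spectrum_def symmetric_subspace_eq eigenvector_def
    by (simp add: conj_ac) blast
  have "l = - 1 \<or> l = 0" if l: "l \<in> restricted_spectrum n E 0" for l
  proof -
    obtain v where v: "v \<in> carrier_vec (2 ^ n)" "v \<noteq> 0\<^sub>v (2 ^ n)"
      and eq: "\<And>s. s < 2 ^ n \<Longrightarrow> - (\<Sum>t<2 ^ n. v $ t) / 2 ^ n = complex_of_real l * v $ s"
      using l unfolding mem by blast
    obtain s where s: "s < 2 ^ n" "v $ s \<noteq> 0"
      using v by (metis carrier_vecD eq_vecI index_zero_vec(1) zero_carrier_vec)
    define \<sigma> where "\<sigma> = (\<Sum>t<2 ^ n. v $ t)"
    have "complex_of_real l * \<sigma> = (\<Sum>s<2 ^ n. complex_of_real l * v $ s)"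
      by (simp add: \<sigma>_def sum_distrib_left)
    also have "\<dots> = (\<Sum>s<(2 :: nat) ^ n. - \<sigma> / 2 ^ n)"
      by (rule sum.cong) (use eq in \<open>auto simp: \<sigma>_def\<close>)
    also have "\<dots> = - \<sigma>" by simp
    finally have "(complex_of_real l + 1) * \<sigma> = 0" by (simp add: algebra_simps)
    moreover have "l = 0" if "\<sigma> = 0" using eq[OF s(1)] s(2) that by (simp add: \<sigma>_def)
    moreover have "l = - 1" if "complex_of_real l + 1 = 0"
      using that by (metis add.inverse_inverse add_eq_0_iff of_real_1 of_real_eq_iff of_real_minus)
    ultimately show ?thesis by auto
  qed
  moreover have "- 1 \<in> restricted_spectrum n E 0"
  proof -
    let ?v = "vec (2 ^ n) (\<lambda>_. 1 :: complex)"
    have "?v $ s0 \<noteq> 0\<^sub>v (2 ^ n) $ s0" using assms by simp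
    then have "?v \<noteq> 0\<^sub>v (2 ^ n)" by auto
    then show ?thesis unfolding mem by (intro bexI[of _ ?v]) auto
  qed
  moreover have "0 \<in> restricted_spectrum n E 0"
  proof -
    define k where "k = level_count n E (E s0)"
    let ?v = "vec (2 ^ n) (\<lambda>s. (if E s = E s0 then 2 ^ n else 0) - of_nat k :: complex)"
    have k: "k > 0" unfolding k_def level_count_def using assms by (subst card_gt_0_iff) auto
    have "?v $ t0 \<noteq> 0\<^sub>v (2 ^ n) $ t0" using assms k by simp
    then have "?v \<noteq> 0\<^sub>v (2 ^ n)" by auto
    moreover have "(\<Sum>t<2 ^ n. ?v $ t) = 0"
    proof -
      have "(\<Sum>t<2 ^ n. ?v $ t) = (\<Sum>t<2 ^ n. (if E t = E s0 then 2 ^ n else 0) - of_nat k)"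
        by (rule sum.cong) auto
      also have "\<dots> = 0"
        by (simp add: sum_subtractf sum.If_cases k_def level_count_def Int_def)
      finally show ?thesis .
    qed
    ultimately show ?thesis unfolding mem by (intro bexI[of _ ?v]) auto
  qed
  ultimately have "restricted_spectrum n E 0 = {- 1, 0}" by blast
  moreover have "{- 1, 0} - {- 1} = {0 :: real}" by auto
  ultimately show ?thesis by (simp add: gap_def two_smallest_gap_def)
qed

end

theory Submission
  imports Defs
begin

text \<open>
  The schedule \<open>z' = c g(z)\<^sup>2\<close> makes \<open>\<parallel>H'\<parallel> / g\<^sup>2\<close> constant, equal to \<open>c \<parallel>H\<^sub>f\<parallel> \<le> c m\<close>, and since
  \<open>\<bar>dg/dz\<bar> \<le> 3 m\<close>, the integral in the adiabatic criterion is at most \<open>13 c m\<^sup>2 \<integral> dz / g\<close>. Both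
  \<open>c = \<integral> dz / g\<^sup>2\<close> and \<open>\<integral> dz / g\<close> are controlled by the bound
  \<open>g(z) \<ge> sqrt ((z - Z\<^sub>1)\<^sup>2 + n\<^sub>0) / (6 m B)\<close> on \<open>[0, B]\<close>: the first is \<open>O(m\<^sup>2 / sqrt n\<^sub>0)\<close> by an
  arctangent, the second \<open>O(m log (1 / n\<^sub>0)) = O(m n)\<close> by an area hyperbolic sine. For \<open>z \<le> Z\<^sub>1\<close> the
  lower bound comes from \<open>\<lambda>\<^sub>0\<close>, for \<open>z \<ge> Z\<^sub>1\<close> from \<open>\<lambda>\<^sub>1\<close>, each time by comparing the sum over the
  positive levels in the secular equation with its value \<open>- Z\<^sub>1 / z\<close> at \<open>\<lambda> = 0\<close>. The stopping point
  stays bounded because \<open>g(z\<^sub>*) \<le> g(0) = 1\<close> forces \<open>z\<^sub>* \<le> 2\<close>.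
\<close>

section \<open>Schedules and integrals along them\<close>

text \<open>Inverse function theorem on an open interval. It supplies every inverse used below: the
  schedule itself and the two roots \<open>\<mu>\<close> and \<open>\<omega>\<close>. Openness of
  \<open>J\<close> makes the derivative of the inverse two-sided.\<close>

lemma DERIV_inv_into:
  fixes f f' :: "real \<Rightarrow> real"
  assumes "open J" "convex J"
    and f: "\<And>x. x \<in> J \<Longrightarrow> (f has_real_derivative f' x) (at x)"
    and pos: "\<And>x. x \<in> J \<Longrightarrow> 0 < f' x"
  shows "strict_mono_on J f"
    and "x \<in> J \<Longrightarrow> (inv_into J f has_real_derivative 1 / f' x) (at (f x))"
proof -
  show mono: "strict_mono_on J f"
  proof (rule strict_mono_onI)
    fix a b assume ab: "a \<in> J" "b \<in> J" "a < b"
    have "x \<in> J" if "a \<le> x" "x \<le> b" for x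
      using \<open>convex J\<close> ab that unfolding is_interval_convex_1[symmetric] is_interval_1 by blast
    then show "f a < f b" using f pos by (intro DERIV_pos_imp_increasing[OF ab(3)]) blast
  qed
  assume x: "x \<in> J"
  have "(inv_into J f has_derivative (\<lambda>y. y / f' x)) (at (f x))"
  proof (rule has_derivative_inverse_strong[where f = f and x = x and S = J
        and f' = "\<lambda>y. f' x * y"])
    show "continuous_on J f"
      by (rule DERIV_continuous_on, rule has_field_derivative_at_within, rule f)
    show "inv_into J f (f y) = y" if "y \<in> J" for y
      using mono that by (simp add: strict_mono_on_imp_inj_on)
    show "(f has_derivative (\<lambda>y. f' x * y)) (at x)"
      using f[OF x] by (simp add: has_field_derivative_def)
    show "(\<lambda>y. f' x * y) \<circ> (\<lambda>y. y / f' x) = id" using pos[OF x] by auto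
  qed (use assms x in auto)
  moreover have "(\<lambda>y. y / f' x) = (*) (1 / f' x)" by auto
  ultimately show "(inv_into J f has_real_derivative 1 / f' x) (at (f x))"
    by (simp add: has_field_derivative_def)
qed

text \<open>Separation of variables: along a solution the primitive \<open>G\<close> of
  \<open>1 / g ^ 2\<close> grows at the constant rate \<open>c\<close>, so \<open>z \<beta>\<close>
  is the inverse of \<open>G\<close> taken at \<open>G 0 + c * \<beta>\<close>.\<close>

lemma gap_rate_schedule:
  fixes g :: "real \<Rightarrow> real"
  assumes cont: "continuous_on {0..} g" and pos: "\<And>x. 0 \<le> x \<Longrightarrow> 0 < g x" and b: "0 < b"
  defines "c \<equiv> integral {0..b} (\<lambda>x. 1 / g x ^ 2)"
  obtains z where "z ` {0..1} \<subseteq> {0..b}" "z 0 = 0" "z 1 = b"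
    "\<And>\<beta>. \<beta> \<in> {0..1} \<Longrightarrow> (z has_real_derivative c * g (z \<beta>) ^ 2) (at \<beta>)"
proof -
  \<comment> \<open>Even reflection extends \<open>1 / g ^ 2\<close> continuously to negative
    arguments. Thus \<open>G\<close> is differentiable on an open interval around
    \<open>{0..b}\<close>, and the derivative of \<open>z\<close> is two-sided even at \<beta> = 0
    and \<beta> = 1.\<close>
  define h where "h x = 1 / g \<bar>x\<bar> ^ 2" for x
  define J where "J = {- 1<..<b + 1}"
  define G where "G x = integral {- 1..x} h" for x
  have h_pos: "0 < h x" for x using pos[of "\<bar>x\<bar>"] by (simp add: h_def)
  have h_cont: "continuous_on S h" for S
  proof -
    have "continuous_on UNIV (\<lambda>x. g \<bar>x\<bar>)"
      by (rule continuous_on_compose2[OF cont]) (auto intro!: continuous_intros)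
    moreover have "g \<bar>x\<bar> \<noteq> 0" for x using pos[of "\<bar>x\<bar>"] by simp
    ultimately have "continuous_on UNIV h"
      unfolding h_def[abs_def]
      by (intro continuous_on_divide continuous_on_power continuous_on_const) auto
    then show ?thesis using continuous_on_subset by blast
  qed
  have G: "(G has_real_derivative h x) (at x)" if "x \<in> J" for x
    using integral_has_real_derivative[OF h_cont[of "{- 1..b + 1}"], of x] that
    unfolding G_def[abs_def] J_def by (simp add: at_within_Icc_at)
  note inv = DERIV_inv_into[of J G h, OF _ _ G h_pos]
  have mono: "strict_mono_on J G" by (rule inv(1)) (auto simp: J_def)
  have J: "0 \<in> J" "b \<in> J" "{0..b} \<subseteq> J" using b by (auto simp: J_def)
  have "G 0 + integral {0..b} h = G b"
    unfolding G_def using b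
    by (intro Henstock_Kurzweil_Integration.integral_combine integrable_continuous_real h_cont) auto
  moreover have "integral {0..b} h = c"
    unfolding c_def by (rule integral_cong) (simp add: h_def)
  ultimately have Gb: "G 0 + c = G b" by simp
  then have c: "0 < c" using strict_mono_onD[OF mono J(1,2) b] by simp
  define z where "z \<beta> = inv_into J G (G 0 + c * \<beta>)" for \<beta>
  have zG: "z \<beta> = x" if "x \<in> J" "G x = G 0 + c * \<beta>" for x \<beta>
    unfolding z_def that(2)[symmetric] using that(1) mono by (simp add: strict_mono_on_imp_inj_on)
  have z: "z \<beta> \<in> {0..b} \<and> G (z \<beta>) = G 0 + c * \<beta>" if "\<beta> \<in> {0..1}" for \<beta>
  proof -
    have "\<exists>x\<ge>0. x \<le> b \<and> G x = G 0 + c * \<beta>"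
    proof (rule IVT)
      have "c * \<beta> \<le> c * 1" using that c by (intro mult_left_mono) auto
      then show "G 0 + c * \<beta> \<le> G b" using Gb by simp
      show "\<forall>x. 0 \<le> x \<and> x \<le> b \<longrightarrow> isCont G x"
        using DERIV_isCont[OF G] J(3) by (auto simp: subset_iff)
    qed (use b c that in auto)
    then obtain x where "x \<in> {0..b}" "G x = G 0 + c * \<beta>" by auto
    then show ?thesis using zG[of x \<beta>] J(3) by auto
  qed
  have "(z has_real_derivative c * g (z \<beta>) ^ 2) (at \<beta>)" if "\<beta> \<in> {0..1}" for \<beta>
  proof -
    have zJ: "z \<beta> \<in> J" and G\<beta>: "G (z \<beta>) = G 0 + c * \<beta>" using z[OF that] J(3) by auto
    have "(inv_into J G has_real_derivative 1 / h (z \<beta>)) (at (G 0 + c * \<beta>))"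
      unfolding G\<beta>[symmetric] using zJ by (intro inv(2)) (auto simp: J_def)
    then have "((\<lambda>\<beta>. inv_into J G (G 0 + c * \<beta>)) has_real_derivative 1 / h (z \<beta>) * c) (at \<beta>)"
      by (rule DERIV_chain2) (auto intro!: derivative_eq_intros)
    moreover have "1 / h (z \<beta>) * c = c * g (z \<beta>) ^ 2" using z[OF that] by (simp add: h_def)
    ultimately show ?thesis unfolding z_def[abs_def] by simp
  qed
  moreover have "z ` {0..1} \<subseteq> {0..b}" using z by blast
  moreover have "z 0 = 0" "z 1 = b" using zG[of 0 0] zG[of b 1] J Gb by auto
  ultimately show ?thesis using that[of z] by blast
qed

text \<open>The bound \<open>lower\<close> puts \<open>1 / g x ^ 2\<close> below a Lorentzian
  centred at \<open>a\<close> of width \<open>sqrt p\<close>. Its mass on the whole line is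
  \<open>R\<^sup>2 * pi / sqrt p\<close>, so the estimate is uniform in \<open>a\<close> and
  \<open>b\<close>.\<close>

lemma integral_inverse_square_le:
  fixes g :: "real \<Rightarrow> real"
  assumes cont: "continuous_on {0..b} g" and pos: "\<And>x. x \<in> {0..b} \<Longrightarrow> 0 < g x"
    and p: "0 < p" and b: "0 \<le> b"
    and lower: "\<And>x. x \<in> {0..b} \<Longrightarrow> (x - a)\<^sup>2 + p \<le> (R * g x)\<^sup>2"
  shows "integral {0..b} (\<lambda>x. 1 / g x ^ 2) \<le> R\<^sup>2 * pi / sqrt p"
proof -
  define A where "A x = R\<^sup>2 / sqrt p * arctan ((x - a) / sqrt p)" for x
  have q: "0 < (x - a)\<^sup>2 + p" for x using p by (simp add: add_nonneg_pos)
  have "(A has_real_derivative R\<^sup>2 / ((x - a)\<^sup>2 + p)) (at x within {0..b})" for x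
  proof -
    have "1 + ((x - a) / sqrt p)\<^sup>2 = ((x - a)\<^sup>2 + p) / p"
      using p by (simp add: power_divide field_simps)
    then have e: "inverse (1 + ((x - a) / sqrt p)\<^sup>2) * (1 / sqrt p) = p / ((x - a)\<^sup>2 + p) / sqrt p"
      by simp
    have "((\<lambda>x. (x - a) / sqrt p) has_real_derivative 1 / sqrt p) (at x)"
      by (intro DERIV_cdivide) (auto intro!: derivative_eq_intros)
    from DERIV_chain2[OF DERIV_arctan this]
    have "((\<lambda>x. arctan ((x - a) / sqrt p)) has_real_derivative p / ((x - a)\<^sup>2 + p) / sqrt p) (at x)"
      unfolding e .
    then have "(A has_real_derivative R\<^sup>2 / sqrt p * (p / ((x - a)\<^sup>2 + p) / sqrt p)) (at x)"
      unfolding A_def[abs_def] by (rule DERIV_cmult)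
    moreover have "R\<^sup>2 / sqrt p * (p / ((x - a)\<^sup>2 + p) / sqrt p) = R\<^sup>2 / ((x - a)\<^sup>2 + p)"
    proof -
      have "y / s * (s * s / d / s) = y / d" if "s \<noteq> 0" for y s d :: real
        using that by simp
      from this[of "sqrt p" "R\<^sup>2" "(x - a)\<^sup>2 + p"] show ?thesis
        using p unfolding real_sqrt_mult_self by simp
    qed
    ultimately show ?thesis by (auto intro: has_field_derivative_at_within)
  qed
  then have int: "((\<lambda>x. R\<^sup>2 / ((x - a)\<^sup>2 + p)) has_integral (A b - A 0)) {0..b}"
    using b by (intro fundamental_theorem_of_calculus)
      (auto simp: has_real_derivative_iff_has_vector_derivative)
  have "continuous_on {0..b} (\<lambda>x. 1 / g x ^ 2)"
    using pos by (intro continuous_on_divide continuous_on_power cont continuous_on_const) force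
  then have "((\<lambda>x. 1 / g x ^ 2) has_integral integral {0..b} (\<lambda>x. 1 / g x ^ 2)) {0..b}"
    by (intro integrable_integral integrable_continuous_real)
  then have "integral {0..b} (\<lambda>x. 1 / g x ^ 2) \<le> A b - A 0"
  proof (rule has_integral_le[OF _ int])
    fix x assume x: "x \<in> {0..b}"
    then show "1 / g x ^ 2 \<le> R\<^sup>2 / ((x - a)\<^sup>2 + p)"
      using lower[OF x] pos[OF x] q[of x] by (simp add: field_simps power_mult_distrib)
  qed
  also have "\<dots> = R\<^sup>2 / sqrt p * (arctan ((b - a) / sqrt p) - arctan ((0 - a) / sqrt p))"
    by (simp add: A_def right_diff_distrib)
  also have "\<dots> \<le> R\<^sup>2 / sqrt p * pi"
    using p arctan_bounded[of "(b - a) / sqrt p"] arctan_bounded[of "(0 - a) / sqrt p"]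
    by (intro mult_left_mono) auto
  finally show ?thesis by simp
qed

lemma arsinh_le_ln:
  fixes x :: real assumes "1 \<le> x" shows "arsinh x \<le> ln (3 * x)"
proof -
  have "sqrt (x\<^sup>2 + 1) \<le> sqrt ((2 * x)\<^sup>2)"
  proof (rule real_sqrt_le_mono)
    show "x\<^sup>2 + 1 \<le> (2 * x)\<^sup>2"
      using one_le_power[OF assms, of 2] by (simp only: power_mult_distrib power2_eq_square[of 2])
  qed
  then have "x + sqrt (x\<^sup>2 + 1) \<le> 3 * x"
    using assms unfolding real_sqrt_abs by linarith
  then show ?thesis
    unfolding arsinh_real_def using arsinh_real_aux[of x] by (intro ln_mono) auto
qed

text \<open>The majorant in \<open>f_le\<close> is the exact derivative of
  \<open>K * arsinh ((z \<beta> - a) / sqrt p)\<close>, so its integral depends only on the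
  endpoints of the curve. Each endpoint contributes at most \<open>arsinh (B / sqrt p)\<close>,
  which is logarithmic in \<open>1 / p\<close>.\<close>

lemma integral_along_schedule_le:
  fixes z z' f :: "real \<Rightarrow> real"
  assumes z: "\<And>\<beta>. \<beta> \<in> {0..1} \<Longrightarrow> (z has_real_derivative z' \<beta>) (at \<beta>)"
    and ends: "\<bar>z 0 - a\<bar> \<le> B" "\<bar>z 1 - a\<bar> \<le> B" and B: "1 \<le> B"
    and p: "1 / 2 ^ n \<le> p" "p \<le> 1" and n: "1 \<le> n"
    and K: "0 \<le> K" and f: "(f has_integral I) {0..1}"
    and f_le: "\<And>\<beta>. \<beta> \<in> {0..1} \<Longrightarrow> f \<beta> \<le> K * (z' \<beta> / sqrt ((z \<beta> - a)\<^sup>2 + p))"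
  shows "I \<le> K * (2 * (3 * B + real n))"
proof -
  have p0: "0 < p" using p(1) by (smt (verit) zero_less_divide_1_iff zero_less_power)
  define A where "A \<beta> = K * arsinh ((z \<beta> - a) / sqrt p)" for \<beta>
  have "(A has_real_derivative K * (z' \<beta> / sqrt ((z \<beta> - a)\<^sup>2 + p))) (at \<beta> within {0..1})"
    if "\<beta> \<in> {0..1}" for \<beta>
  proof -
    have "((z \<beta> - a) / sqrt p)\<^sup>2 + 1 = ((z \<beta> - a)\<^sup>2 + p) / p"
      using p0 by (simp add: power_divide field_simps)
    then have s: "sqrt (((z \<beta> - a) / sqrt p)\<^sup>2 + 1) = sqrt ((z \<beta> - a)\<^sup>2 + p) / sqrt p"
      by (simp add: real_sqrt_divide)
    have "((\<lambda>\<beta>. (z \<beta> - a) / sqrt p) has_real_derivative z' \<beta> / sqrt p) (at \<beta>)"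
      using z[OF that] by (intro DERIV_cdivide) (auto intro!: derivative_eq_intros)
    from DERIV_chain2[OF arsinh_real_has_field_derivative this]
    have "(A has_real_derivative
        K * (1 / sqrt (((z \<beta> - a) / sqrt p)\<^sup>2 + 1) * (z' \<beta> / sqrt p))) (at \<beta>)"
      unfolding A_def[abs_def] by (rule DERIV_cmult)
    then show ?thesis unfolding s using p0 by (auto intro: has_field_derivative_at_within)
  qed
  then have "((\<lambda>\<beta>. K * (z' \<beta> / sqrt ((z \<beta> - a)\<^sup>2 + p))) has_integral (A 1 - A 0)) {0..1}"
    by (intro fundamental_theorem_of_calculus)
      (auto simp: has_real_derivative_iff_has_vector_derivative)
  with f have I: "I \<le> A 1 - A 0" using f_le by (rule has_integral_le)
  have sp: "sqrt p \<le> 1" "0 < sqrt p" using p(2) p0 by auto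
  have "1 * sqrt p \<le> B" using B sp by linarith
  then have B1: "1 \<le> B / sqrt p" using sp by (simp add: le_divide_eq)
  have "arsinh (B / sqrt p) \<le> ln (3 * (B / sqrt p))" by (rule arsinh_le_ln[OF B1])
  also have "\<dots> = ln (3 * B) + ln (1 / p) / 2"
    using B p0 by (simp add: ln_mult ln_div ln_sqrt)
  also have "ln (3 * B) \<le> 3 * B" using B ln_le_minus_one[of "3 * B"] by simp
  \<comment> \<open>The lower bound \<open>1 / 2 ^ n\<close> on \<open>p\<close> turns the logarithm
    into a term linear in \<open>n\<close>.\<close>
  also have "ln (1 / p) / 2 \<le> real n"
  proof -
    have "1 / p \<le> 2 ^ n" using p(1) p0 by (simp add: field_simps)
    then have "ln (1 / p) \<le> ln (2 ^ n)" using p0 by (intro ln_mono) auto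
    also have "\<dots> = real n * ln 2" by (simp add: ln_realpow)
    also have "\<dots> \<le> real n * 2" using ln_le_minus_one[of "2 :: real"] by (intro mult_left_mono) auto
    finally show ?thesis by simp
  qed
  finally have b: "arsinh (B / sqrt p) \<le> 3 * B + real n" by simp
  have bound: "\<bar>arsinh (x / sqrt p)\<bar> \<le> 3 * B + real n" if "\<bar>x\<bar> \<le> B" for x
  proof -
    have "x / sqrt p \<le> B / sqrt p" "- x / sqrt p \<le> B / sqrt p"
      using that p0 by (auto intro!: divide_right_mono simp del: minus_divide_left[symmetric])
    then have "arsinh (x / sqrt p) \<le> arsinh (B / sqrt p)"
        "arsinh (- x / sqrt p) \<le> arsinh (B / sqrt p)"
      using strict_mono_less_eq[of arsinh] arsinh_real_strict_mono strict_monoI by blast+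
    then show ?thesis using b by simp
  qed
  have "A 1 - A 0 = K * (arsinh ((z 1 - a) / sqrt p) - arsinh ((z 0 - a) / sqrt p))"
    by (simp add: A_def right_diff_distrib)
  also have "\<dots> \<le> K * (2 * (3 * B + real n))"
    using bound[OF ends(1)] bound[OF ends(2)] K by (intro mult_left_mono) auto
  finally show ?thesis using I by simp
qed

section \<open>The two smallest secular roots\<close>

locale level_weights =
  fixes A :: "nat set" and p :: "nat \<Rightarrow> real" and m :: nat
  assumes finite_A: "finite A" and A_nonempty: "A \<noteq> {}" and A_le: "A \<subseteq> {1..m}"
    and p_pos: "\<And>e. e \<in> A \<Longrightarrow> 0 < p e" and p0_pos: "0 < p 0"
    and p_sum: "p 0 + sum p A = 1"
begin

text \<open>With \<open>p\<close> the level densities and \<open>A\<close> the occupied positive levels, the secular equation at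
  \<open>\<lambda> = z x\<close> reads \<open>F x = z\<close>. Its root in \<open>(0, e_min)\<close> is \<open>\<mu> z = \<lambda>\<^sub>1 / z\<close>. Its negative root is
  \<open>- 1 / \<omega> z\<close>, where \<open>w * Q w = F (- 1 / w)\<close>; the substitution \<open>x = - 1 / w\<close> keeps \<open>\<lambda>\<^sub>0 = - Q (\<omega> z)\<close>
  differentiable at \<open>z = 0\<close>. So \<open>g\<close> is the gap.\<close>

definition F :: "real \<Rightarrow> real" where
  "F x = - p 0 / x + (\<Sum>e\<in>A. p e / (real e - x))"

definition F' :: "real \<Rightarrow> real" where
  "F' x = p 0 / x ^ 2 + (\<Sum>e\<in>A. p e / (real e - x) ^ 2)"

definition Q :: "real \<Rightarrow> real" where
  "Q w = p 0 + (\<Sum>e\<in>A. p e / (1 + real e * w))"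

definition Q' :: "real \<Rightarrow> real" where
  "Q' w = - (\<Sum>e\<in>A. p e * real e / (1 + real e * w) ^ 2)"

text \<open>Derivative of \<open>w * Q w\<close>, the left-hand side of the equation that determines
  \<open>\<omega>\<close>.\<close>

definition P' :: "real \<Rightarrow> real" where
  "P' w = p 0 + (\<Sum>e\<in>A. p e / (1 + real e * w) ^ 2)"

definition e_min :: real where "e_min = real (Min A)"

definition \<mu> :: "real \<Rightarrow> real" where
  "\<mu> = inv_into {0<..<e_min} F"

definition \<omega> :: "real \<Rightarrow> real" where
  "\<omega> = inv_into {- 1 / real m<..} (\<lambda>w. w * Q w)"

definition g :: "real \<Rightarrow> real" where
  "g z = z * \<mu> z + Q (\<omega> z)"

definition g' :: "real \<Rightarrow> real" where
  "g' z = \<mu> z + z / F' (\<mu> z) + Q' (\<omega> z) / P' (\<omega> z)"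

section \<open>The function \<open>F\<close> and its root between the poles 0 and
  \<open>e_min\<close>\<close>

lemma A_ge1: "e \<in> A \<Longrightarrow> 1 \<le> real e" and A_le_m: "e \<in> A \<Longrightarrow> real e \<le> real m"
  using A_le by auto

lemma m_ge1: "1 \<le> real m"
  using A_nonempty A_ge1 A_le_m by (meson all_not_in_conv order_trans)

lemma e_min_in: "\<exists>e\<in>A. e_min = real e" and e_min_le: "e \<in> A \<Longrightarrow> e_min \<le> real e"
  using finite_A A_nonempty by (auto simp: e_min_def)

lemma e_min_ge1: "1 \<le> e_min" and e_min_le_m: "e_min \<le> real m"
  using e_min_in A_ge1 A_le_m by auto

lemma p_sum_A_le: "sum p A \<le> 1" and p0_le: "p 0 \<le> 1"
  using sum_pos[OF finite_A A_nonempty, of p] p_pos p_sum p0_pos by auto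

lemma F_deriv:
  assumes "x \<noteq> 0" "\<And>e. e \<in> A \<Longrightarrow> x \<noteq> real e"
  shows "(F has_real_derivative F' x) (at x)"
proof -
  have "((\<lambda>x. p e / (real e - x)) has_real_derivative p e / (real e - x) ^ 2) (at x)"
    if "e \<in> A" for e
    using assms(2)[OF that] by (auto intro!: derivative_eq_intros simp: power2_eq_square)
  moreover have "((\<lambda>x. - p 0 / x) has_real_derivative p 0 / x ^ 2) (at x)"
    using assms(1) by (auto intro!: derivative_eq_intros simp: power2_eq_square)
  ultimately show ?thesis
    unfolding F_def F'_def by (intro DERIV_add DERIV_sum) auto
qed

lemma F'_pos:
  assumes "x \<noteq> 0" shows "0 < F' x"
  unfolding F'_def using assms p0_pos p_pos
  by (intro add_pos_nonneg sum_nonneg divide_pos_pos) (auto simp: less_imp_le)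

lemma F_deriv_lower: "0 < x \<Longrightarrow> x < e_min \<Longrightarrow> (F has_real_derivative F' x) (at x)"
  using e_min_le by (intro F_deriv) (auto dest: leD)

lemma F_strict_mono_neg: "strict_mono_on {..<0} F"
  by (rule DERIV_inv_into(1)[where f' = F']) (auto intro!: F_deriv F'_pos)

lemma F_strict_mono: "strict_mono_on {0<..<e_min} F"
  by (rule DERIV_inv_into(1)[where f' = F']) (auto intro!: F_deriv_lower F'_pos)

text \<open>\<open>F\<close> runs from minus infinity at the pole 0 to plus infinity at the pole
  \<open>e_min\<close>. Explicit points \<open>a\<close> and \<open>b\<close> with
  \<open>F a \<le> z \<le> F b\<close> stand in for the two limits.\<close>

lemma F_surj: "\<exists>x\<in>{0<..<e_min}. F x = z"
proof -
  define S where "S x = (\<Sum>e\<in>A. p e / (real e - x))" for x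
  have S_mono: "S x \<le> S y" if "x \<le> y" "y < e_min" for x y
    unfolding S_def using that e_min_le
    by (intro sum_mono divide_left_mono less_imp_le[OF p_pos] mult_pos_pos) force+
  have S_nonneg: "0 \<le> S x" if "x < e_min" for x
    unfolding S_def using that e_min_le
    by (intro sum_nonneg divide_nonneg_nonneg less_imp_le[OF p_pos]) force+
  define h where "h = e_min / 2"
  have h: "0 < h" "h < e_min" using e_min_ge1 by (auto simp: h_def)
  \<comment> \<open>Near 0 the term \<open>- p 0 / x\<close> dominates: this \<open>a\<close> makes
    \<open>p 0 / a\<close> at least \<open>S h + \<bar>z\<bar> + 1\<close>, while
    \<open>S a \<le> S h\<close> by monotonicity.\<close>
  define a where "a = min h (p 0 / (S h + \<bar>z\<bar> + 1))"
  have d: "0 < S h + \<bar>z\<bar> + 1" using S_nonneg[OF h(2)] by linarith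
  have a: "0 < a" "a \<le> h" using h p0_pos d by (auto simp: a_def)
  have "S h + \<bar>z\<bar> + 1 \<le> p 0 / a"
  proof -
    have "a \<le> p 0 / (S h + \<bar>z\<bar> + 1)" by (simp add: a_def)
    then show ?thesis using d a(1) by (simp add: le_divide_eq mult.commute)
  qed
  then have Fa: "F a \<le> z"
    using S_mono[OF a(2) h(2)] unfolding F_def S_def[symmetric] by simp
  obtain e where e: "e \<in> A" "e_min = real e" using e_min_in by blast
  define D where "D = \<bar>z\<bar> + p 0 / h + 1"
  have D: "0 < D" using h p0_pos by (simp add: D_def add_nonneg_pos)
  \<comment> \<open>Near \<open>e_min\<close> the single summand of level \<open>e\<close>
    dominates: it reaches \<open>D\<close>, which leaves at least \<bar>z\<bar> after subtracting
    \<open>p 0 / b \<le> p 0 / h\<close>.\<close>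
  define b where "b = max h (e_min - p e / D)"
  have b: "h \<le> b" "b < e_min" using h p_pos[OF e(1)] D by (auto simp: b_def)
  have "D \<le> p e / (e_min - b)"
  proof -
    have "e_min - b \<le> p e / D" by (simp add: b_def)
    then show ?thesis using D b(2) by (simp add: le_divide_eq mult.commute)
  qed
  also have "\<dots> \<le> S b"
    unfolding S_def e(2) using b e_min_le finite_A e
    by (intro member_le_sum[where f = "\<lambda>e. p e / (real e - b)"]
        divide_nonneg_nonneg less_imp_le[OF p_pos]) force+
  finally have "D \<le> S b" .
  moreover have "p 0 / b \<le> p 0 / h" using b h p0_pos by (intro divide_left_mono) auto
  ultimately have Fb: "z \<le> F b"
    unfolding F_def S_def[symmetric] D_def by simp
  have "\<exists>x\<ge>a. x \<le> b \<and> F x = z"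
    using Fa Fb a b h by (intro IVT) (auto intro!: DERIV_isCont[OF F_deriv_lower])
  then show ?thesis using a b by force
qed

lemma \<mu>: "0 < \<mu> z" "\<mu> z < e_min" "F (\<mu> z) = z"
proof -
  have z: "z \<in> F ` {0<..<e_min}" using F_surj[of z] by blast
  show "0 < \<mu> z" "\<mu> z < e_min" "F (\<mu> z) = z"
    using inv_into_into[OF z] f_inv_into_f[OF z] by (auto simp: \<mu>_def)
qed

lemma \<mu>_deriv: "(\<mu> has_real_derivative 1 / F' (\<mu> z)) (at z)"
  using DERIV_inv_into(2)[of "{0<..<e_min}" F F' "\<mu> z"] F_deriv_lower F'_pos \<mu>[of z]
  unfolding \<mu>_def[symmetric] by simp

section \<open>The function \<open>Q\<close> and the negative root\<close>

lemma denominator_pos: "- 1 / real m < w \<Longrightarrow> e \<in> A \<Longrightarrow> 0 < 1 + real e * w"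
proof -
  assume w: "- 1 / real m < w" and e: "e \<in> A"
  have "- 1 / real e \<le> - 1 / real m"
    using A_ge1[OF e] A_le_m[OF e] m_ge1 by (simp add: field_simps)
  with w have "- 1 / real e < w" by linarith
  then show ?thesis using A_ge1[OF e] by (simp add: field_simps)
qed

lemma Q_deriv:
  assumes "- 1 / real m < w"
  shows "(Q has_real_derivative Q' w) (at w)"
proof -
  have "((\<lambda>w. p e / (1 + real e * w)) has_real_derivative - (p e * real e / (1 + real e * w) ^ 2))
      (at w)" if "e \<in> A" for e
    using denominator_pos[OF assms that]
    by (auto intro!: derivative_eq_intros simp: power2_eq_square)
  then show ?thesis
    unfolding Q_def Q'_def sum_negf[symmetric]
    by (subst add_0_left[symmetric], intro DERIV_add DERIV_sum DERIV_const) auto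
qed

text \<open>The product rule gives \<open>Q w + w * Q' w\<close>. For each level,
  \<open>1 / (1 + e w) - e w / (1 + e w) ^ 2\<close> collapses to \<open>1 / (1 + e w) ^ 2\<close>,
  a form in which positivity is visible.\<close>

lemma P_deriv:
  assumes "- 1 / real m < w"
  shows "((\<lambda>w. w * Q w) has_real_derivative P' w) (at w)"
proof -
  have "p e / (1 + real e * w) ^ 2 =
      p e / (1 + real e * w) - w * (p e * real e / (1 + real e * w) ^ 2)"
    if "e \<in> A" for e
  proof -
    have "1 + real e * w \<noteq> 0" using denominator_pos[OF assms that] by simp
    then have "p e / (1 + real e * w) = p e * (1 + real e * w) / (1 + real e * w) ^ 2"
      by (simp add: power2_eq_square)
    then show ?thesis by (simp add: algebra_simps add_divide_distrib)
  qed
  then have "P' w = Q w + w * Q' w"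
    unfolding P'_def Q_def Q'_def sum_distrib_left sum_negf[symmetric] mult_minus_right
    by (simp add: sum_subtractf sum_negf)
  then show ?thesis using Q_deriv[OF assms] by (auto intro!: derivative_eq_intros)
qed

lemma P'_pos: "0 < P' w"
  unfolding P'_def using p0_pos p_pos
  by (intro add_pos_nonneg sum_nonneg) (auto simp: less_imp_le)

lemma Q_ge: "0 \<le> w \<Longrightarrow> p 0 \<le> Q w"
  unfolding Q_def using p_pos
  by (auto intro!: sum_nonneg divide_nonneg_nonneg simp: less_imp_le)

lemma P_strict_mono: "strict_mono_on {- 1 / real m<..} (\<lambda>w. w * Q w)"
  by (rule DERIV_inv_into(1)[where f' = P']) (auto intro!: P_deriv P'_pos)

lemma \<omega>:
  assumes "0 \<le> z" shows "0 \<le> \<omega> z" "\<omega> z * Q (\<omega> z) = z"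
proof -
  have pole: "- 1 / real m < w" if "0 \<le> w" for w
    using that m_ge1 by (smt (verit) divide_neg_pos)
  have "\<exists>w\<ge>0. w \<le> z / p 0 \<and> w * Q w = z"
  proof (rule IVT)
    \<comment> \<open>Since \<open>Q w \<ge> p 0\<close> for nonnegative \<open>w\<close>, the
      product has reached \<open>z\<close> by the time \<open>w = z / p 0\<close>.\<close>
    show "z \<le> z / p 0 * Q (z / p 0)"
      using assms p0_pos Q_ge[of "z / p 0"] by (simp add: field_simps mult_left_mono)
    show "\<forall>w. 0 \<le> w \<and> w \<le> z / p 0 \<longrightarrow> isCont (\<lambda>w. w * Q w) w"
      using pole DERIV_isCont[OF P_deriv] by blast
  qed (use assms p0_pos in auto)
  then obtain w where w: "0 \<le> w" "w * Q w = z" by blast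
  then have "\<omega> z = w"
    unfolding \<omega>_def w(2)[symmetric] using pole P_strict_mono
    by (intro inv_into_f_f[where f = "\<lambda>w. w * Q w"] strict_mono_on_imp_inj_on) auto
  then show "0 \<le> \<omega> z" "\<omega> z * Q (\<omega> z) = z" using w by auto
qed

lemma \<omega>_pole: "0 \<le> z \<Longrightarrow> - 1 / real m < \<omega> z"
  using \<omega>(1)[of z] m_ge1 by (smt (verit) divide_neg_pos)

text \<open>The domain \<open>{- 1 / real m<..}\<close> contains none of the poles
  \<open>- 1 / real e\<close> of \<open>Q\<close> and has 0 in its interior. Hence the derivative is
  two-sided also at \<open>z = 0\<close>.\<close>

lemma \<omega>_deriv: "0 \<le> z \<Longrightarrow> (\<omega> has_real_derivative 1 / P' (\<omega> z)) (at z)"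
  using DERIV_inv_into(2)[of "{- 1 / real m<..}" "\<lambda>w. w * Q w" P' "\<omega> z"] P_deriv P'_pos \<omega>_pole[of z]
    \<omega>(2)[of z]
  unfolding \<omega>_def[symmetric] by simp

section \<open>Smoothness and slope of the gap function\<close>

lemma g_deriv:
  assumes "0 \<le> z" shows "(g has_real_derivative g' z) (at z)"
proof -
  have "((\<lambda>z. Q (\<omega> z)) has_real_derivative Q' (\<omega> z) * (1 / P' (\<omega> z))) (at z)"
    using DERIV_chain2[OF Q_deriv[OF \<omega>_pole[OF assms]] \<omega>_deriv[OF assms]] .
  then show ?thesis
    unfolding g_def[abs_def] g'_def by (auto intro!: derivative_eq_intros \<mu>_deriv)
qed

lemma continuous_on_g: "continuous_on {0..} g"
  by (rule DERIV_continuous_on, rule has_field_derivative_at_within, rule g_deriv) simp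

text \<open>The second derivative of the schedule brings \<open>g'\<close> into the adiabatic
  integrand; its continuity makes that integrand integrable.\<close>

lemma continuous_on_g': "continuous_on {0..} g'"
proof -
  have \<mu>c: "continuous_on {0..} \<mu>"
    by (rule DERIV_continuous_on, rule has_field_derivative_at_within, rule \<mu>_deriv)
  have \<omega>c: "continuous_on {0..} \<omega>"
    by (rule DERIV_continuous_on, rule has_field_derivative_at_within, rule \<omega>_deriv) simp
  have \<mu>: "\<mu> z \<noteq> 0" "e \<in> A \<Longrightarrow> real e - \<mu> z \<noteq> 0" for e z
    using \<mu>(1,2)[of z] e_min_le[of e] by auto
  have \<omega>: "1 + real e * \<omega> z \<noteq> 0" if "z \<in> {0..}" "e \<in> A" for e z
    using denominator_pos[OF \<omega>_pole, of z e] that by auto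
  note continuous = continuous_on_add continuous_on_minus continuous_on_mult continuous_on_divide
    continuous_on_sum continuous_on_power continuous_on_diff continuous_on_const continuous_on_id
  have F': "continuous_on {0..} (\<lambda>z. F' (\<mu> z))"
    unfolding F'_def by (intro continuous \<mu>c ballI) (use \<mu> in \<open>auto simp: \<mu>\<close>)
  have P': "continuous_on {0..} (\<lambda>z. P' (\<omega> z))"
    unfolding P'_def by (intro continuous \<omega>c ballI) (simp_all add: \<omega>)
  have Q': "continuous_on {0..} (\<lambda>z. Q' (\<omega> z))"
    unfolding Q'_def by (intro continuous \<omega>c ballI) (simp_all add: \<omega>)
  have nz: "F' (\<mu> z) \<noteq> 0" "P' (\<omega> z) \<noteq> 0" for z
    using F'_pos[OF \<mu>(1)[of z]] P'_pos[of "\<omega> z"] by auto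
  show ?thesis
    unfolding g'_def[abs_def] by (intro continuous \<mu>c F' P' Q' ballI) (simp_all add: nz)
qed

lemma g_pos: "0 \<le> z \<Longrightarrow> 0 < g z"
  using Q_ge[OF \<omega>(1)[of z]] p0_pos \<mu>(1)[of z] by (simp add: g_def add_nonneg_pos)

text \<open>At \<open>z = 0\<close> the negative root is minus the total weight, because
  \<open>\<omega> 0 = 0\<close>. The value agrees with \<open>gap_at_zero\<close>, so
  \<open>g\<close> is the gap there as well.\<close>

lemma g_at_zero: "g 0 = 1"
proof -
  have "\<omega> 0 = 0"
    using \<omega>[of 0] Q_ge[OF \<omega>(1)[of 0]] p0_pos by auto
  then show ?thesis using p_sum by (simp add: g_def Q_def)
qed

text \<open>Each of the three summands of \<open>g'\<close> is at most \<open>m\<close> in absolute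
  value. For the second, \<open>z = F (\<mu> z) \<le> m * F' (\<mu> z)\<close>, because every
  \<open>real e - \<mu> z\<close> is at most \<open>m\<close>; for the third,
  \<open>- Q' \<le> m * P'\<close> holds term by term because \<open>e \<le> m\<close>.\<close>

lemma abs_g'_le:
  assumes "0 \<le> z" shows "\<bar>g' z\<bar> \<le> 3 * real m"
proof -
  have d: "0 < real e - \<mu> z" "real e - \<mu> z \<le> real m" if "e \<in> A" for e
    using \<mu>(1,2)[of z] e_min_le[OF that] A_le_m[OF that] by linarith+
  have *: "p e / (real e - \<mu> z) \<le> real m * (p e / (real e - \<mu> z) ^ 2)" if "e \<in> A" for e
  proof -
    have "p e * (real e - \<mu> z) \<le> p e * real m"
      using d[OF that] p_pos[OF that] by (intro mult_left_mono) auto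
    then have "p e * (real e - \<mu> z) / (real e - \<mu> z) ^ 2 \<le> p e * real m / (real e - \<mu> z) ^ 2"
      by (rule divide_right_mono) simp
    then show ?thesis using d(1)[OF that] by (simp add: power2_eq_square mult.commute)
  qed
  have "z = F (\<mu> z)" using \<mu>(3) by simp
  also have "\<dots> \<le> (\<Sum>e\<in>A. p e / (real e - \<mu> z))"
    using \<mu>(1)[of z] p0_pos by (simp add: F_def)
  also have "\<dots> \<le> (\<Sum>e\<in>A. real m * (p e / (real e - \<mu> z) ^ 2))" by (rule sum_mono) (rule *)
  also have "\<dots> \<le> real m * F' (\<mu> z)"
    unfolding sum_distrib_left[symmetric] using p0_pos
    by (intro mult_left_mono) (simp_all add: F'_def)
  finally have 1: "z / F' (\<mu> z) \<le> real m"
    using F'_pos[of "\<mu> z"] \<mu>(1)[of z] by (simp add: divide_le_eq)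
  have "- Q' (\<omega> z) \<le> (\<Sum>e\<in>A. real m * (p e / (1 + real e * \<omega> z) ^ 2))"
    unfolding Q'_def minus_minus
  proof (rule sum_mono)
    fix e assume e: "e \<in> A"
    have "p e / (1 + real e * \<omega> z) ^ 2 * real e \<le> p e / (1 + real e * \<omega> z) ^ 2 * real m"
      using A_le_m[OF e] p_pos[OF e] by (intro mult_left_mono) auto
    then show "p e * real e / (1 + real e * \<omega> z) ^ 2 \<le> real m * (p e / (1 + real e * \<omega> z) ^ 2)"
      by (simp add: mult.commute)
  qed
  also have "\<dots> \<le> real m * P' (\<omega> z)"
    unfolding sum_distrib_left[symmetric] using p0_pos
    by (intro mult_left_mono) (simp_all add: P'_def)
  finally have "- Q' (\<omega> z) \<le> real m * P' (\<omega> z)" .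
  moreover have "Q' (\<omega> z) \<le> 0"
    unfolding Q'_def using p_pos by (auto intro!: sum_nonneg simp: less_imp_le)
  ultimately have 2: "\<bar>Q' (\<omega> z) / P' (\<omega> z)\<bar> \<le> real m"
    using P'_pos[of "\<omega> z"] unfolding abs_divide by (subst pos_divide_le_eq) auto
  have "0 \<le> z / F' (\<mu> z)" using assms F'_pos[of "\<mu> z"] \<mu>(1)[of z] by simp
  then show ?thesis
    using 1 2 \<mu>(1,2)[of z] e_min_le_m unfolding g'_def by linarith
qed

section \<open>Identification of \<open>g\<close> with the distance of the two smallest
  roots\<close>

lemma F_neg_root:
  assumes "0 < z" shows "0 < \<omega> z" "F (- 1 / \<omega> z) = z"
proof -
  show w: "0 < \<omega> z" using \<omega>[of z] assms by (cases "\<omega> z = 0") auto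
  have "p e / (real e - - 1 / \<omega> z) = \<omega> z * (p e / (1 + real e * \<omega> z))" for e
    using w by (simp add: field_simps)
  then have "F (- 1 / \<omega> z) = \<omega> z * Q (\<omega> z)"
    by (simp add: F_def Q_def distrib_left sum_distrib_left mult.commute)
  then show "F (- 1 / \<omega> z) = z" using \<omega>[of z] assms by simp
qed

text \<open>Strict monotonicity of \<open>F\<close> on the negative axis leaves one negative root,
  and on the interval from 0 to \<open>e_min\<close> it excludes roots between 0 and
  \<open>\<mu> z\<close>. The roots above need no description beyond finiteness of \<open>S\<close>,
  which gives \<open>Min\<close> its meaning.\<close>

lemma two_smallest_gap_roots:
  assumes z: "0 < z" and "finite S"
    and S: "\<And>x. z * x \<in> S \<longleftrightarrow> x \<noteq> 0 \<and> x \<notin> real ` A \<and> F x = z"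
  shows "two_smallest_gap S = g z"
proof -
  have S': "\<exists>x. l = z * x \<and> x \<noteq> 0 \<and> F x = z" if "l \<in> S" for l
    using S[of "l / z"] that z by (intro exI[of _ "l / z"]) auto
  define a where "a = - Q (\<omega> z)"
  define b where "b = z * \<mu> z"
  have a: "a = z * (- 1 / \<omega> z)"
    using \<omega>(2)[of z] z F_neg_root(1)[OF z] by (simp add: a_def field_simps)
  have aS: "a \<in> S"
  proof -
    have "- 1 / \<omega> z < 0" using F_neg_root(1)[OF z] by simp
    moreover have "- 1 / \<omega> z \<notin> real ` A"
    proof
      assume "- 1 / \<omega> z \<in> real ` A"
      then obtain e where "- 1 / \<omega> z = real e" by blast
      then show False using \<open>- 1 / \<omega> z < 0\<close> by (metis not_le of_nat_0_le_iff)
    qed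
    ultimately show ?thesis unfolding a S using F_neg_root(2)[OF z] by simp
  qed
  have bS: "b \<in> S"
    unfolding b_def S using \<mu>[of z] e_min_le by fastforce
  have a0: "a < 0" and b0: "0 < b" using z F_neg_root(1)[OF z] \<mu>(1)[of z] by (auto simp: a b_def)
  have neg: "l = a" if "l \<in> S" "l \<le> 0" for l
  proof -
    obtain x where x: "l = z * x" "x \<noteq> 0" "F x = z" using S'[OF \<open>l \<in> S\<close>] by blast
    then have "x < 0" using z \<open>l \<le> 0\<close> by (simp add: mult_le_0_iff less_le)
    then have "x = - 1 / \<omega> z"
      using strict_mono_on_eqD[OF F_strict_mono_neg, of x "- 1 / \<omega> z"] x F_neg_root[OF z] by auto
    then show ?thesis using x a by simp
  qed
  have pos: "b \<le> l" if "l \<in> S" "0 < l" for l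
  proof (rule ccontr)
    assume lb: "\<not> b \<le> l"
    obtain x where x: "l = z * x" "x \<noteq> 0" "F x = z" using S'[OF \<open>l \<in> S\<close>] by blast
    have "0 < x" "x < \<mu> z" using lb z x(1) that(2) by (auto simp: b_def zero_less_mult_iff)
    then show False
      using strict_mono_onD[OF F_strict_mono, of x "\<mu> z"] x \<mu>[of z] by auto
  qed
  have "a \<le> l" if "l \<in> S" for l
    using neg[OF that] pos[OF that] a0 b0 by (cases "l \<le> 0") simp_all
  then have "Min S = a" using \<open>finite S\<close> aS by (intro Min_eqI)
  moreover have "b \<le> l" if "l \<in> S - {a}" for l
    using neg[of l] pos[of l] that by (cases "l \<le> 0") simp_all
  then have "Min (S - {a}) = b" using \<open>finite S\<close> bS a0 b0 by (intro Min_eqI) auto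
  ultimately show ?thesis by (simp add: two_smallest_gap_def a_def b_def g_def)
qed

section \<open>Lower bound on the gap and location of its minimum\<close>

definition Z1 :: real where "Z1 = (\<Sum>e\<in>A. p e / real e)"

lemma Z1: "0 \<le> Z1" "Z1 \<le> 1"
proof -
  show "0 \<le> Z1" unfolding Z1_def using p_pos
    by (intro sum_nonneg divide_nonneg_nonneg) (auto simp: less_imp_le)
  have "Z1 \<le> sum p A"
    unfolding Z1_def using A_ge1 p_pos by (intro sum_mono) (force simp: divide_le_eq)
  then show "Z1 \<le> 1" using p_sum_A_le by simp
qed

text \<open>Subtracting \<open>z = w * Q w\<close> from \<open>Z1\<close> and multiplying by
  \<open>w\<close> gives \<open>(Z1 - z) * w + p 0 * w\<^sup>2\<close> as a sum of terms
  \<open>p e * w / (e * (1 + e * w)) \<le> p e\<close>, hence at most 1. For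
  \<open>z \<le> Z1\<close> both summands are nonnegative, so the second and the square of the first
  are each at most 1.\<close>

lemma inverse_\<omega>_lower:
  assumes "0 \<le> z" "z \<le> Z1"
  shows "((z - Z1)\<^sup>2 + p 0) * (\<omega> z)\<^sup>2 \<le> 2"
proof -
  define w where "w = \<omega> z"
  have w: "0 \<le> w" "z = w * Q w" using \<omega>[OF assms(1)] by (auto simp: w_def)
  have *: "(p e / real e - w * (p e / (1 + real e * w))) * w \<le> p e" if e: "e \<in> A" for e
  proof -
    have e1: "1 \<le> real e" using A_ge1[OF e] .
    then have nn: "0 < 1 + real e * w" using w by (simp add: add_pos_nonneg)
    have "(p e / real e - w * (p e / (1 + real e * w))) * w
        = p e * (w / (real e * (1 + real e * w)))"
      using e1 nn by (simp add: field_simps)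
    also have "\<dots> \<le> p e * 1"
    proof (rule mult_left_mono)
      have "w \<le> real e * w" using e1 w by (simp add: mult_le_cancel_right1)
      also have "\<dots> \<le> real e * (1 + real e * w)"
        using e1 w \<open>w \<le> real e * w\<close> by (intro mult_left_mono) auto
      finally show "w / (real e * (1 + real e * w)) \<le> 1" using e1 nn by (simp add: divide_le_eq)
    qed (use p_pos[OF e] in simp)
    finally show ?thesis by simp
  qed
  have "(Z1 - z) * w + p 0 * w\<^sup>2 = (\<Sum>e\<in>A. (p e / real e - w * (p e / (1 + real e * w))) * w)"
    unfolding Z1_def w(2) Q_def
    by (simp add: sum_distrib_left sum_distrib_right left_diff_distrib sum_subtractf distrib_left
        distrib_right power2_eq_square algebra_simps)
  also have "\<dots> \<le> sum p A" by (rule sum_mono) (rule *)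
  finally have le: "(Z1 - z) * w + p 0 * w\<^sup>2 \<le> 1" using p_sum_A_le by simp
  have nn: "0 \<le> (Z1 - z) * w" "0 \<le> p 0 * w\<^sup>2" using assms w p0_pos by auto
  then have "((Z1 - z) * w)\<^sup>2 \<le> 1" using le by (simp add: power_le_one_iff abs_square_le_1)
  then show ?thesis using le nn
    by (simp add: w_def[symmetric] power_mult_distrib power2_commute distrib_right)
qed

text \<open>Subtracting \<open>Z1\<close> from \<open>F x = z\<close> at \<open>x = \<mu> z\<close>
  gives \<open>z - Z1 + p 0 / x \<le> 2 * x\<close>, where the 2 comes from
  \<open>e * (e - x) \<ge> 1 / 2\<close>. Both summands are nonnegative for
  \<open>Z1 \<le> z\<close>, which yields 4 + 2 = 6.\<close>

lemma \<mu>_lower: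
  assumes "Z1 \<le> z" "\<mu> z \<le> 1 / 2"
  shows "(z - Z1)\<^sup>2 + p 0 \<le> 6 * (\<mu> z)\<^sup>2"
proof -
  define x where "x = \<mu> z"
  have x: "0 < x" "x \<le> 1 / 2" using \<mu>(1) assms by (auto simp: x_def)
  have "p e / (real e - x) - p e / real e \<le> p e * (2 * x)" if e: "e \<in> A" for e
  proof -
    have e1: "1 \<le> real e" using A_ge1[OF e] .
    then have "1 * (1 / 2) \<le> real e * (real e - x)" using x by (intro mult_mono) auto
    moreover have "p e / (real e - x) - p e / real e = p e * (x / (real e * (real e - x)))"
      using e1 x by (simp add: field_simps)
    moreover have "x / (real e * (real e - x)) \<le> x / (1 / 2)"
      using x calculation(1) by (intro divide_left_mono) auto
    ultimately show ?thesis
      using mult_left_mono[of "x / (real e * (real e - x))" "2 * x" "p e"] p_pos[OF e]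
      by simp
  qed
  then have "(\<Sum>e\<in>A. p e / (real e - x) - p e / real e) \<le> (\<Sum>e\<in>A. p e * (2 * x))"
    by (rule sum_mono)
  also have "\<dots> \<le> 2 * x"
    unfolding sum_distrib_right[symmetric] using p_sum_A_le x by (simp add: mult_le_cancel_right1)
  finally have "z - Z1 + p 0 / x \<le> 2 * x"
    using \<mu>(3)[of z] by (simp add: F_def Z1_def sum_subtractf x_def[symmetric])
  then have le: "z - Z1 \<le> 2 * x" "p 0 / x \<le> 2 * x"
    using assms p0_pos x divide_pos_pos[of "p 0" x] by linarith+
  then have "(z - Z1)\<^sup>2 \<le> (2 * x)\<^sup>2" using assms by (intro power_mono) auto
  moreover have "p 0 \<le> 2 * x\<^sup>2" using le x by (simp add: field_simps power2_eq_square)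
  ultimately show ?thesis by (simp add: x_def[symmetric] power_mult_distrib)
qed

text \<open>Four regimes. If \<open>z \<le> 1 / (2 m)\<close> or \<open>\<mu> z \<ge> 1 / 2\<close>,
  the gap is at least a constant over \<open>m\<close> and the crude bound \<open>sq\<close>
  suffices. Otherwise \<open>z \<ge> 1 / (2 m)\<close> transfers the bound on
  \<open>1 / \<omega> z\<close> to \<open>Q w = z / w\<close>, or the bound on
  \<open>\<mu> z\<close> to \<open>z * \<mu> z\<close>.\<close>

lemma g_lower:
  assumes z: "0 \<le> z" "z \<le> B" and B: "2 \<le> B"
  shows "(z - Z1)\<^sup>2 + p 0 \<le> (6 * real m * B * g z)\<^sup>2"
proof -
  define w where "w = \<omega> z"
  have w: "0 \<le> w" "z = w * Q w" using \<omega>[OF z(1)] by (auto simp: w_def)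
  have gQ: "Q w \<le> g z" and g\<mu>: "z * \<mu> z \<le> g z"
    using z(1) \<mu>(1)[of z] Q_ge[OF w(1)] p0_pos by (auto simp: g_def w_def)
  have mB: "1 * 2 \<le> real m * B" using m_ge1 B by (intro mult_mono) auto
  have g0: "0 < g z" using g_pos[OF z(1)] .
  \<comment> \<open>\<open>C\<close> and \<open>u\<close> carry the constants of the single regimes;
    the largest \<open>C * u\<^sup>2\<close> that occurs is 32, within 36 = 6 * 6.\<close>
  have final: ?thesis if "(z - Z1)\<^sup>2 + p 0 \<le> C * (u * (real m * B * g z))\<^sup>2" "C * u\<^sup>2 \<le> 36" for C u
  proof -
    have "C * u\<^sup>2 * (real m * B * g z)\<^sup>2 \<le> 36 * (real m * B * g z)\<^sup>2"
      using that(2) by (rule mult_right_mono) simp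
    then show ?thesis using that(1) by (simp add: power_mult_distrib mult.assoc)
  qed
  have sq: "(z - Z1)\<^sup>2 + p 0 \<le> 2 * B\<^sup>2"
  proof -
    have "\<bar>z - Z1\<bar> \<le> B" using z Z1 B by linarith
    then have "(z - Z1)\<^sup>2 \<le> B\<^sup>2" using power_mono[of "\<bar>z - Z1\<bar>" B 2] by simp
    moreover have "1 \<le> B\<^sup>2" using B by (simp add: one_le_power)
    ultimately show ?thesis using p0_le by linarith
  qed
  consider "z \<le> 1 / (2 * real m)" | "1 / (2 * real m) \<le> z" "z \<le> Z1"
    | "1 / (2 * real m) \<le> z" "Z1 \<le> z" "\<mu> z \<le> 1 / 2" | "1 / (2 * real m) \<le> z" "1 / 2 \<le> \<mu> z"
    by linarith
  then show ?thesis
  proof cases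
    case 1
    have mw: "0 < 1 + real m * w" using w by (simp add: add_pos_nonneg)
    have term_le: "p e / (1 + real m * w) \<le> p e / (1 + real e * w)" if "e \<in> A" for e
      using w A_le_m[OF that] p_pos[OF that]
      by (intro divide_left_mono mult_pos_pos add_pos_nonneg) (auto intro: mult_right_mono)
    \<comment> \<open>Replacing every level by \<open>m\<close> bounds \<open>Q w\<close> below by
      \<open>1 / (1 + m w)\<close>. Since \<open>w * Q w = z\<close>, this reads
      \<open>Q w \<ge> 1 - m z\<close>, hence \<open>Q w \<ge> 1 / 2\<close>.\<close>
    have "1 / (1 + real m * w) = p 0 / (1 + real m * w) + (\<Sum>e\<in>A. p e / (1 + real m * w))"
      by (simp flip: sum_divide_distrib add_divide_distrib add: p_sum)
    also have "\<dots> \<le> Q w"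
      unfolding Q_def using w p0_pos mw
      by (intro add_mono sum_mono term_le) (auto simp: divide_le_eq)
    finally have Q1: "1 \<le> Q w * (1 + real m * w)" using mw by (simp add: divide_le_eq)
    have "Q w * (real m * w) = real m * z" using w by simp
    also have "\<dots> \<le> 1 / 2" using 1 m_ge1 by (simp add: field_simps)
    finally have "1 / 2 \<le> Q w" using Q1 by (simp add: distrib_left)
    then have "B * 1 \<le> B * real m * (2 * g z)" using gQ m_ge1 B
      by (simp only: mult.assoc, intro mult_left_mono)
        (auto intro!: order_trans[OF m_ge1] simp: mult_le_cancel_left1)
    then have "B\<^sup>2 \<le> (2 * (real m * B * g z))\<^sup>2" using B by (intro power_mono) (auto simp: mult_ac)
    then show ?thesis using sq by (intro final[of 2 2]) auto
  next
    case 2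
    have "0 < z" using 2 m_ge1 by (smt (verit) zero_less_divide_1_iff)
    then have w0: "0 < w" using F_neg_root(1) by (simp add: w_def)
    have "1 \<le> 2 * real m * z" using 2(1) m_ge1 by (simp add: field_simps)
    also have "\<dots> = 2 * real m * w * Q w" using w by simp
    also have "\<dots> \<le> 2 * real m * w * g z" using gQ w by (intro mult_left_mono) auto
    also have "\<dots> \<le> (real m * B) * w * g z"
      using B m_ge1 w g0 by (intro mult_right_mono) auto
    finally have "1\<^sup>2 \<le> ((real m * B * g z) * w)\<^sup>2" by (intro power_mono) (auto simp: mult_ac)
    then have "((z - Z1)\<^sup>2 + p 0) * w\<^sup>2 \<le> 2 * (real m * B * g z)\<^sup>2 * w\<^sup>2"
      using inverse_\<omega>_lower[OF z(1) 2(2)] by (simp add: w_def power_mult_distrib)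
    then have "(z - Z1)\<^sup>2 + p 0 \<le> 2 * (real m * B * g z)\<^sup>2"
      using w0 by (subst (asm) mult_le_cancel_right_pos) auto
    then show ?thesis by (intro final[of 2 1]) auto
  next
    case 3
    have "1 \<le> 2 * real m * z" using 3(1) m_ge1 by (simp add: field_simps)
    then have "1 * \<mu> z \<le> 2 * real m * z * \<mu> z" using \<mu>(1)[of z] by (intro mult_right_mono) auto
    also have "\<dots> \<le> 2 * real m * g z" using g\<mu> by (simp only: mult.assoc, intro mult_left_mono) auto
    also have "\<dots> \<le> real m * B * g z" using B m_ge1 g0 by (intro mult_right_mono) auto
    finally have "(\<mu> z)\<^sup>2 \<le> (real m * B * g z)\<^sup>2" using \<mu>(1)[of z] by (intro power_mono) auto
    then show ?thesis using \<mu>_lower[OF 3(2,3)] by (intro final[of 6 1]) auto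
  next
    case 4
    have "1 / (2 * real m) * (1 / 2) \<le> z * \<mu> z" using 4 m_ge1 z by (intro mult_mono) auto
    then have "1 / (4 * real m) \<le> g z" using g\<mu> by simp
    then have "1 \<le> 4 * (real m * g z)" using m_ge1 by (simp add: field_simps)
    then have "B * 1 \<le> B * (4 * (real m * g z))" using B by (intro mult_left_mono) auto
    then have "B\<^sup>2 \<le> (4 * (real m * B * g z))\<^sup>2" using B by (intro power_mono) (auto simp: mult_ac)
    then show ?thesis using sq by (intro final[of 2 4]) auto
  qed
qed

text \<open>For \<open>z > 2\<close> a gap of at most 1 would force
  \<open>\<mu> z \<le> 1 / 2\<close>. Then every denominator in \<open>F (\<mu> z)\<close> is at
  least 1 / 2 and \<open>z = F (\<mu> z) \<le> 2\<close>. As \<open>g 0 = 1\<close>, this locates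
  any minimum of the gap.\<close>

lemma g_le_one_imp_le_2:
  assumes "g z \<le> 1" "0 \<le> z" shows "z \<le> 2"
proof (rule ccontr)
  assume "\<not> z \<le> 2"
  have "z * \<mu> z \<le> 1" using assms Q_ge[OF \<omega>(1)[OF assms(2)]] p0_pos by (auto simp: g_def)
  moreover have "2 * \<mu> z \<le> z * \<mu> z" using \<open>\<not> z \<le> 2\<close> \<mu>(1)[of z] by (intro mult_right_mono) auto
  ultimately have \<mu>2: "\<mu> z \<le> 1 / 2" by simp
  have "p e / (real e - \<mu> z) \<le> p e / (1 / 2)" if "e \<in> A" for e
    using A_ge1[OF that] p_pos[OF that] \<mu>2 by (intro divide_left_mono) auto
  then have "(\<Sum>e\<in>A. p e / (real e - \<mu> z)) \<le> (\<Sum>e\<in>A. p e / (1 / 2))" by (rule sum_mono)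
  also have "\<dots> \<le> 2" using p_sum_A_le by (simp add: sum_distrib_right[symmetric])
  finally have "F (\<mu> z) \<le> 2" using p0_pos \<mu>(1)[of z] by (simp add: F_def)
      (smt (verit) divide_pos_pos)
  then show False using \<open>\<not> z \<le> 2\<close> \<mu>(3) by simp
qed

end

section \<open>Evolution time of the schedule\<close>

lemma mat_diag_mult_vec:
  "v \<in> carrier_vec d \<Longrightarrow> mat_diag d f *\<^sub>v v = vec d (\<lambda>i. f i * v $ i)"
  by (rule eq_vecI) (auto simp: mat_diag_def scalar_prod_def if_distrib if_distribR cong: if_cong)

text \<open>The supremum is attained at the basis vector of the largest diagonal entry. Both
  derivatives of the Hamiltonian along a schedule are multiples of the diagonal
  \<open>final_hamiltonian\<close>, so this evaluates their norms exactly.\<close>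

lemma mat_op_norm_diag:
  assumes s: "s < d" and max: "\<And>i. i < d \<Longrightarrow> cmod (f i) \<le> cmod (f s)"
  shows "mat_op_norm (mat_diag d f) = cmod (f s)"
  unfolding mat_op_norm_def
proof (rule cSup_eq_maximum)
  have "mat_diag d f *\<^sub>v unit_vec d s = vec d (\<lambda>i. f i * unit_vec d s $ i)"
    by (rule mat_diag_mult_vec) simp
  then have "vec_norm2 (mat_diag d f *\<^sub>v unit_vec d s) =
      L2_set (\<lambda>i. if i = s then cmod (f s) else 0) {..<d}"
    unfolding vec_norm2_def by (auto intro!: L2_set_cong simp: unit_vec_def)
  moreover have "L2_set (\<lambda>i. if i = s then c else 0) {..<d} = \<bar>c\<bar>" for c :: real
    using s by (simp add: L2_set_def if_distrib[of "\<lambda>x. x\<^sup>2"] cong: if_cong)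
  moreover have "vec_norm2 (unit_vec d s) = L2_set (\<lambda>i. if i = s then 1 else 0) {..<d}"
    unfolding vec_norm2_def by (auto intro!: L2_set_cong simp: unit_vec_def)
  ultimately show "cmod (f s) \<in> (\<lambda>v. vec_norm2 (mat_diag d f *\<^sub>v v)) `
      {v \<in> carrier_vec (dim_col (mat_diag d f)). vec_norm2 v \<le> 1}"
    by (intro image_eqI[of _ _ "unit_vec d s"]) (auto simp: mat_diag_def)
next
  fix x assume "x \<in> (\<lambda>v. vec_norm2 (mat_diag d f *\<^sub>v v)) `
      {v \<in> carrier_vec (dim_col (mat_diag d f)). vec_norm2 v \<le> 1}"
  then obtain v where v: "v \<in> carrier_vec d" "vec_norm2 v \<le> 1" "x = vec_norm2 (mat_diag d f *\<^sub>v v)"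
    by (auto simp: mat_diag_def)
  have "x = L2_set (\<lambda>i. cmod (f i) * cmod (v $ i)) {..<d}"
    unfolding v(3) mat_diag_mult_vec[OF v(1)] vec_norm2_def
    by (auto intro!: L2_set_cong simp: norm_mult)
  also have "\<dots> \<le> L2_set (\<lambda>i. cmod (f s) * cmod (v $ i)) {..<d}"
    by (intro L2_set_mono mult_right_mono max) auto
  also have "\<dots> = cmod (f s) * vec_norm2 v"
    using v(1) by (simp add: vec_norm2_def L2_set_right_distrib)
  also have "\<dots> \<le> cmod (f s)" using v(2) by (simp add: mult_left_le)
  finally show "x \<le> cmod (f s)" .
qed

lemma mat_op_norm_smult_final_hamiltonian:
  assumes "s < 2 ^ n" "\<And>t. t < 2 ^ n \<Longrightarrow> E t \<le> E s"
  shows "mat_op_norm (complex_of_real r \<cdot>\<^sub>m final_hamiltonian n E) = \<bar>r\<bar> * real (E s)"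
proof -
  have "complex_of_real r \<cdot>\<^sub>m final_hamiltonian n E
      = mat_diag (2 ^ n) (\<lambda>s. complex_of_real r * of_nat (E s))"
    by (auto simp: final_hamiltonian_def mat_diag_def)
  moreover have "mat_op_norm \<dots> = cmod (complex_of_real r * of_nat (E s))"
    using assms by (intro mat_op_norm_diag) (auto simp: norm_mult intro!: mult_left_mono)
  ultimately show ?thesis by (simp add: norm_mult)
qed

text \<open>Serves both derivatives: with \<open>B\<close> the initial Hamiltonian it differentiates
  the Hamiltonian along the schedule, with \<open>B = 0\<close> the resulting first
  derivative.\<close>

lemma has_mat_derivative_affine:
  assumes u: "(u has_real_derivative u') F" and D: "D \<in> carrier_mat d d"
    and A: "\<And>x i j. i < d \<Longrightarrow> j < d \<Longrightarrow>
      A x $$ (i, j) = B $$ (i, j) + complex_of_real (u x) * D $$ (i, j)"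
  shows "has_mat_derivative d A (complex_of_real u' \<cdot>\<^sub>m D) F"
  unfolding has_mat_derivative_def
proof (intro conjI allI impI)
  fix i j assume ij: "i < d" "j < d"
  have "((\<lambda>x. complex_of_real (u x)) has_vector_derivative complex_of_real u') F"
    using u by (rule has_vector_derivative_of_real)
  from has_vector_derivative_mult_left[OF this, of "D $$ (i, j)"]
  have "((\<lambda>x. B $$ (i, j) + complex_of_real (u x) * D $$ (i, j)) has_vector_derivative
      complex_of_real u' * D $$ (i, j)) F"
    using has_vector_derivative_add[OF has_vector_derivative_const] by fastforce
  then show "((\<lambda>x. A x $$ (i, j)) has_vector_derivative (complex_of_real u' \<cdot>\<^sub>m D) $$ (i, j)) F"
    using D ij by (simp add: A[OF ij])
qed (use D in simp)

lemma finite_restricted_spectrum: "finite (restricted_spectrum n E z)"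
proof (rule finite_subset)
  let ?H = "hamiltonian n E z"
  show "restricted_spectrum n E z \<subseteq> complex_of_real -` {k. poly (char_poly ?H) k = 0}"
    unfolding restricted_spectrum_def
    using eigenvalue_root_char_poly[OF hamiltonian_carrier, of n E z] by (auto simp: eigenvalue_def)
  have "char_poly ?H \<noteq> 0"
    using degree_monic_char_poly[OF hamiltonian_carrier, of n E z] by auto
  then show "finite (complex_of_real -` {k. poly (char_poly ?H) k = 0})"
    by (intro finite_vimageI poly_roots_finite) (auto intro: inj_onI)
qed

section \<open>From a cost function to level weights\<close>

lemma level_count_pos_iff: "0 < level_count n E e \<longleftrightarrow> (\<exists>s < 2 ^ n. E s = e)"
  unfolding level_count_def by (subst card_gt_0_iff) auto

lemma sum_level_density:
  assumes E: "\<And>s. s < 2 ^ n \<Longrightarrow> E s \<le> m"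
  shows "level_density n E 0 + (\<Sum>e = 1..m. level_density n E e) = 1"
proof -
  have "(\<Sum>e = 0..m. real (level_count n E e)) = 2 ^ n"
    using sum_levels[of n E m "\<lambda>_. 1 :: real", OF E] by simp
  then have "(\<Sum>e = 0..m. level_density n E e) = 1"
    by (simp add: level_density_def flip: sum_divide_distrib)
  then show ?thesis by (simp add: sum.atLeast_Suc_atMost)
qed

definition positive_levels :: "nat \<Rightarrow> nat \<Rightarrow> (nat \<Rightarrow> nat) \<Rightarrow> nat set" where
  "positive_levels n m E = {e \<in> {1..m}. 0 < level_count n E e}"

lemma sum_positive_levels:
  "(\<Sum>e = 1..m. level_density n E e * f e) = (\<Sum>e\<in>positive_levels n m E. level_density n E e * f e)"
  by (rule sum.mono_neutral_right) (auto simp: positive_levels_def level_density_def)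

lemma level_weights_instance:
  assumes E: "\<And>s. s < 2 ^ n \<Longrightarrow> E s \<le> m"
    and ground: "0 < level_count n E 0" "level_count n E 0 < 2 ^ n"
  shows "level_weights (positive_levels n m E) (level_density n E) m"
proof
  have sum: "level_density n E 0 + sum (level_density n E) (positive_levels n m E) = 1"
    using sum_level_density[of n E m, OF E] sum_positive_levels[of n E "\<lambda>_. 1" m] by simp
  then show "level_density n E 0 + sum (level_density n E) (positive_levels n m E) = 1" .
  have "level_density n E 0 < 1"
    using ground(2) by (simp add: level_density_def)
  then show "positive_levels n m E \<noteq> {}" using sum by auto
qed (use ground in \<open>auto simp: positive_levels_def level_density_def\<close>)

text \<open>For \<open>z > 0\<close> the secular roots are \<open>z * x\<close> with
  \<open>F x = z\<close>. At \<open>z = 0\<close> this scaling degenerates, and the two values are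
  compared directly.\<close>

lemma gap_eq:
  assumes E: "\<And>s. s < 2 ^ n \<Longrightarrow> E s \<le> m"
    and ground: "0 < level_count n E 0" "level_count n E 0 < 2 ^ n"
    and z: "0 \<le> z"
  shows "gap n E z = level_weights.g (positive_levels n m E) (level_density n E) m z"
proof -
  define A where "A = positive_levels n m E"
  define p where "p = level_density n E"
  interpret level_weights A p m
    unfolding A_def p_def using E ground by (rule level_weights_instance)
  have "gap n E z = g z"
  proof (cases "z = 0")
    case True
    obtain s0 where s0: "s0 < 2 ^ n" "E s0 = 0" using ground(1) level_count_pos_iff by blast
    obtain e where "e \<in> A" using A_nonempty by blast
    then obtain t0 where "t0 < 2 ^ n" "E t0 \<noteq> 0"
      by (force simp: A_def positive_levels_def level_count_pos_iff)
    then show ?thesis using True gap_at_zero[of s0 n t0 E] s0 g_at_zero by auto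
  next
    case False
    then have z: "0 < z" using z by simp
    have sec: "secular n m E z (z * x) = (z - F x) / z" for x
    proof -
      have "p e / (z * x - z * real e) = - (p e / (real e - x)) / z" for e
      proof -
        have "z * x - z * real e = - (z * (real e - x))" by (simp add: algebra_simps)
        then show ?thesis by (simp add: mult.commute)
      qed
      then have "(\<Sum>e = 1..m. p e / (z * x - z * real e)) =
          (\<Sum>e = 1..m. p e * (- 1 / (real e - x) / z))"
        by simp
      also have "\<dots> = (\<Sum>e\<in>A. p e * (- 1 / (real e - x) / z))"
        unfolding A_def p_def by (rule sum_positive_levels)
      also have "\<dots> = - (\<Sum>e\<in>A. p e / (real e - x)) / z"
        by (simp add: sum_divide_distrib sum_negf)
      finally have "1 + (p 0 / (z * x) + (\<Sum>e = 1..m. p e / (z * x - z * real e))) = (z - F x) / z"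
        using z by (simp add: F_def diff_divide_distrib add_divide_distrib mult.commute)
      moreover have "secular n m E z (z * x) = 1 + (\<Sum>e = 0..m. p e / (z * x - z * real e))"
        by (simp add: secular_def p_def level_density_def sum_divide_distrib mult.commute)
      ultimately show ?thesis by (simp add: sum.atLeast_Suc_atMost)
    qed
    have "two_smallest_gap (secular_roots n m E z) = g z"
    proof (rule two_smallest_gap_roots[OF z])
      show "finite (secular_roots n m E z)"
        using finite_restricted_spectrum[of n E z]
        by (simp only: restricted_spectrum_eq_secular_roots[of z n E m, OF z E])
      fix x
      have "(\<forall>e\<le>m. 0 < level_count n E e \<longrightarrow> x \<noteq> real e) \<longleftrightarrow> x \<noteq> 0 \<and> x \<notin> real ` A"
      proof (intro iffI conjI allI impI)
        assume H: "\<forall>e\<le>m. 0 < level_count n E e \<longrightarrow> x \<noteq> real e"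
        show "x \<noteq> 0" using H[rule_format, of 0] ground(1) by simp
        show "x \<notin> real ` A" using H by (auto simp: A_def positive_levels_def)
      next
        fix e assume "x \<noteq> 0 \<and> x \<notin> real ` A" "e \<le> m" "0 < level_count n E e"
        then show "x \<noteq> real e" by (cases "e = 0") (auto simp: A_def positive_levels_def)
      qed
      then show "z * x \<in> secular_roots n m E z \<longleftrightarrow> x \<noteq> 0 \<and> x \<notin> real ` A \<and> F x = z"
        using z by (auto simp: secular_roots_def sec)
    qed
    then show ?thesis using gap_eq_secular_roots[OF z E] by simp
  qed
  then show ?thesis by (simp add: A_def p_def)
qed

section \<open>The adiabatic criterion along the schedule\<close>

definition time_factor :: "real \<Rightarrow> real \<Rightarrow> real" where
  "time_factor B \<epsilon> = 36 * B\<^sup>2 * pi * (2 + 156 * B * (3 * B + 1)) / \<epsilon>"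

text \<open>Of \<open>m ^ 5\<close>, two powers come from \<open>R\<^sup>2\<close> in the bound on
  \<open>c\<close>, one from \<open>R\<close> in the integral and two from the norms and the slope
  of the gap. In \<open>time_factor\<close>, \<open>36 * B\<^sup>2 * pi\<close> stems from
  \<open>c\<close>, the 2 from the maximum, and 156 = 13 * 6 * 2 from the integral.\<close>

lemma adiabatic_time_bound:
  assumes E: "\<And>s. s < 2 ^ n \<Longrightarrow> E s \<le> m"
    and ground: "0 < level_count n E 0" "level_count n E 0 < 2 ^ n"
    and n: "1 \<le> n" and \<epsilon>: "0 < \<epsilon>" and B: "2 \<le> B" and zf: "0 < zf" "zf \<le> B"
  shows "\<exists>z T. gap_schedule n E zf z \<and> adiabatic_time n E \<epsilon> z T \<and>
    0 \<le> T \<and> T \<le> time_factor B \<epsilon> * real m ^ 5 * real n * sqrt (2 ^ n / real (level_count n E 0))"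
proof -
  define A where "A = positive_levels n m E"
  define p where "p = level_density n E"
  interpret level_weights A p m
    unfolding A_def p_def using E ground by (rule level_weights_instance)
  have gap: "gap n E x = g x" if "0 \<le> x" for x
    unfolding A_def p_def using E ground that by (rule gap_eq)
  define c where "c = integral {0..zf} (\<lambda>x. 1 / g x ^ 2)"
  obtain z where z: "z ` {0..1} \<subseteq> {0..zf}" "z 0 = 0" "z 1 = zf"
    and z': "\<And>\<beta>. \<beta> \<in> {0..1} \<Longrightarrow> (z has_real_derivative c * g (z \<beta>) ^ 2) (at \<beta>)"
    using gap_rate_schedule[OF continuous_on_g g_pos zf(1)] unfolding c_def by blast
  have z0: "0 \<le> z \<beta>" "z \<beta> \<le> zf" if "\<beta> \<in> {0..1}" for \<beta>
    using subsetD[OF z(1) imageI[OF that]] by simp_all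
  have g0: "0 < g (z \<beta>)" if "\<beta> \<in> {0..1}" for \<beta> using g_pos z0[OF that] by simp
  define R where "R = 6 * real m * B"
  have R: "0 < R" using m_ge1 B by (simp add: R_def)
  have lower: "(x - Z1)\<^sup>2 + p 0 \<le> (R * g x)\<^sup>2" if "x \<in> {0..zf}" for x
    unfolding R_def using that zf B by (intro g_lower) auto
  have cont_g: "continuous_on {0..zf} g" using continuous_on_g by (rule continuous_on_subset) auto
  have inv_int: "(\<lambda>x. 1 / g x ^ 2) integrable_on {0..zf}"
    using g_pos by (intro integrable_continuous_real continuous_on_divide continuous_on_power cont_g
        continuous_on_const) force
  have c0: "0 \<le> c" unfolding c_def by (intro integral_nonneg inv_int) simp
  have c_le: "c \<le> R\<^sup>2 * pi / sqrt (p 0)"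
    unfolding c_def using g_pos zf lower p0_pos
    by (intro integral_inverse_square_le[where a = Z1] cont_g) auto
  have gap_int: "integral {0..zf} (\<lambda>x. 1 / gap n E x ^ 2) = c"
    unfolding c_def by (rule integral_cong) (simp add: gap)
  have schedule: "gap_schedule n E zf z"
    unfolding gap_schedule_def gap_int
  proof (intro conjI ballI)
    show "(\<lambda>x. 1 / gap n E x ^ 2) integrable_on {0..zf}"
      using inv_int by (rule integrable_eq) (simp add: gap)
    show "(z has_real_derivative c * gap n E (z \<beta>) ^ 2) (at \<beta> within {0..1})" if "\<beta> \<in> {0..1}" for \<beta>
      using z'[OF that] z0[OF that] by (simp add: gap has_field_derivative_at_within)
  qed (use z in auto)

  \<comment> \<open>\<open>m\<close> only bounds the costs; the operator norm of the final
    Hamiltonian is the largest cost that occurs, attained at \<open>s\<close>.\<close>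
  obtain s where s: "s < 2 ^ n" "\<And>t. t < 2 ^ n \<Longrightarrow> E t \<le> E s"
  proof -
    have "Max (E ` {..<2 ^ n}) \<in> E ` {..<2 ^ n}"
      by (rule Max_in) (auto simp: lessThan_empty_iff)
    then obtain s where "s < 2 ^ n" "Max (E ` {..<2 ^ n}) = E s" by auto
    then show ?thesis using that[of s]
      by (metis Max_ge finite_imageI finite_lessThan imageI lessThan_iff)
  qed
  define K where "K = real (E s)"
  have K: "0 \<le> K" "K \<le> real m" using E[OF s(1)] by (auto simp: K_def)
  define D where "D = final_hamiltonian n E"
  define u where "u \<beta> = c * g (z \<beta>) ^ 2" for \<beta>
  define u' where "u' \<beta> = 2 * c\<^sup>2 * g (z \<beta>) ^ 3 * g' (z \<beta>)" for \<beta>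
  have D: "D \<in> carrier_mat (2 ^ n) (2 ^ n)" by (simp add: D_def final_hamiltonian_def mat_diag_def)
  have norm_D: "mat_op_norm (complex_of_real r \<cdot>\<^sub>m D) = \<bar>r\<bar> * K" for r
    unfolding D_def K_def using s by (rule mat_op_norm_smult_final_hamiltonian)
  have du: "(u has_real_derivative u' \<beta>) (at \<beta>)" if "\<beta> \<in> {0..1}" for \<beta>
  proof -
    have "((\<lambda>\<beta>. g (z \<beta>)) has_real_derivative g' (z \<beta>) * (c * g (z \<beta>) ^ 2)) (at \<beta>)"
      using DERIV_chain2[OF g_deriv[OF z0(1)[OF that]] z'[OF that]] .
    then show ?thesis
      unfolding u_def[abs_def] u'_def
      by (auto intro!: derivative_eq_intros simp: power2_eq_square power3_eq_cube)
  qed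
  define f where "f \<beta> = mat_op_norm (complex_of_real (u' \<beta>) \<cdot>\<^sub>m D) / gap n E (z \<beta>) ^ 2
      + 7 * mat_op_norm (complex_of_real (u \<beta>) \<cdot>\<^sub>m D) ^ 2 / gap n E (z \<beta>) ^ 3" for \<beta>
  \<comment> \<open>The first and second derivatives carry \<open>g ^ 2\<close> and
    \<open>g ^ 3 * g'\<close>, so after division both summands of the integrand are left with a
    single factor \<open>g\<close>.\<close>
  have f_eq: "f \<beta> = c\<^sup>2 * g (z \<beta>) * K * (2 * \<bar>g' (z \<beta>)\<bar> + 7 * K)" if "\<beta> \<in> {0..1}" for \<beta>
  proof -
    have g: "0 < g (z \<beta>)" using g0[OF that] .
    have "\<bar>u' \<beta>\<bar> = 2 * c\<^sup>2 * g (z \<beta>) ^ 3 * \<bar>g' (z \<beta>)\<bar>"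
      unfolding u'_def abs_mult using g by simp
    then show ?thesis
      unfolding f_def norm_D gap[OF z0(1)[OF that]] u_def using g
      by (simp add: power2_eq_square power3_eq_cube field_simps)
  qed
  have cont_z: "continuous_on {0..1} z"
    by (rule DERIV_continuous_on, rule has_field_derivative_at_within, rule z')
  have "continuous_on {0..1} (\<lambda>\<beta>. c\<^sup>2 * g (z \<beta>) * K * (2 * \<bar>g' (z \<beta>)\<bar> + 7 * K))"
    by (intro continuous_on_add continuous_on_mult continuous_on_const continuous_on_rabs
        continuous_on_compose2[OF continuous_on_g cont_z]
        continuous_on_compose2[OF continuous_on_g' cont_z])
      (auto simp: z0)
  then have "(\<lambda>\<beta>. c\<^sup>2 * g (z \<beta>) * K * (2 * \<bar>g' (z \<beta>)\<bar> + 7 * K)) integrable_on {0..1}"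
    by (rule integrable_continuous_real)
  then have "f integrable_on {0..1}" by (rule integrable_eq) (simp add: f_eq)
  then obtain I where I: "(f has_integral I) {0..1}" by blast
  have f0: "0 \<le> f \<beta>" if "\<beta> \<in> {0..1}" for \<beta>
    using g0[OF that] K c0 by (simp add: f_eq[OF that])
  have I0: "0 \<le> I" using I f0 by (rule has_integral_nonneg)
  have I_le: "I \<le> 13 * c * (real m)\<^sup>2 * R * (2 * (3 * B + real n))"
  proof (rule integral_along_schedule_le[where z = z and a = Z1 and p = "p 0", OF z'])
    show "\<bar>z 0 - Z1\<bar> \<le> B" "\<bar>z 1 - Z1\<bar> \<le> B" using z zf Z1 B by auto
    show "1 / 2 ^ n \<le> p 0" using ground(1) by (simp add: p_def level_density_def divide_right_mono)
    \<comment> \<open>Here 13 = 2 * 3 + 7, from \<open>\<bar>g'\<bar> \<le> 3 m\<close> and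
      \<open>K \<le> m\<close>. The remaining factor \<open>g\<close> is traded for
      \<open>R * g ^ 2 / q\<close> by means of \<open>q \<le> R * g\<close>; this recreates the
      derivative \<open>c * g ^ 2\<close> of the schedule.\<close>
    show "f \<beta> \<le> 13 * c * (real m)\<^sup>2 * R * (c * g (z \<beta>) ^ 2 / sqrt ((z \<beta> - Z1)\<^sup>2 + p 0))"
      if "\<beta> \<in> {0..1}" for \<beta>
    proof -
      define G where "G = g (z \<beta>)"
      define q where "q = sqrt ((z \<beta> - Z1)\<^sup>2 + p 0)"
      have G: "0 < G" using g0[OF that] by (simp add: G_def)
      have q: "0 < q" using p0_pos by (simp add: q_def add_nonneg_pos)
      have "q \<le> R * G"
        unfolding q_def G_def using lower[of "z \<beta>"] z0[OF that] R g0[OF that]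
        by (intro real_le_lsqrt) auto
      then have 1: "1 * G \<le> (R * G / q) * G" using q G
        by (intro mult_right_mono) (auto simp: le_divide_eq)
      have "2 * \<bar>g' (z \<beta>)\<bar> + 7 * K \<le> 13 * real m"
        using abs_g'_le[OF z0(1)[OF that]] K by linarith
      then have "K * (2 * \<bar>g' (z \<beta>)\<bar> + 7 * K) \<le> real m * (13 * real m)"
        using K by (intro mult_mono) auto
      moreover have "G \<le> R * G / q * G" using 1 by simp
      ultimately have "G * (K * (2 * \<bar>g' (z \<beta>)\<bar> + 7 * K))
          \<le> R * G / q * G * (real m * (13 * real m))"
        by (intro mult_mono[of G "R * G / q * G"]) (use K G q R in auto)
      then have "c\<^sup>2 * (G * (K * (2 * \<bar>g' (z \<beta>)\<bar> + 7 * K)))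
          \<le> c\<^sup>2 * (R * G / q * G * (real m * (13 * real m)))"
        by (rule mult_left_mono) simp
      then show ?thesis
        unfolding f_eq[OF that] G_def[symmetric] q_def[symmetric]
        by (simp add: power2_eq_square mult_ac)
    qed
  qed (use I B n R c0 p0_le in auto)

  define T where "T = (2 * (c * K) + I) / \<epsilon>"
  \<comment> \<open>The schedule makes this quotient constant in \<beta>, so the maximum is attained
    everywhere.\<close>
  have ratio: "mat_op_norm (complex_of_real (u \<beta>) \<cdot>\<^sub>m D) / gap n E (z \<beta>) ^ 2 = c * K"
    if "\<beta> \<in> {0..1}" for \<beta>
    unfolding norm_D gap[OF z0(1)[OF that]] u_def using g0[OF that] c0 by simp
  have time: "adiabatic_time n E \<epsilon> z T"
    unfolding adiabatic_time_def
  proof (rule exI[of _ "\<lambda>\<beta>. complex_of_real (u \<beta>) \<cdot>\<^sub>m D"],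
      rule exI[of _ "\<lambda>\<beta>. complex_of_real (u' \<beta>) \<cdot>\<^sub>m D"],
      rule exI[of _ "c * K"], rule exI[of _ I], intro conjI ballI)
    fix \<beta> :: real assume \<beta>: "\<beta> \<in> {0..1}"
    show "has_mat_derivative (2 ^ n) (\<lambda>b. hamiltonian n E (z b)) (complex_of_real (u \<beta>) \<cdot>\<^sub>m D)
        (at \<beta> within {0..1})"
      using has_field_derivative_at_within[OF z'[OF \<beta>]] D
      unfolding u_def
      by (rule has_mat_derivative_affine[where B = "initial_hamiltonian n"])
        (use D in \<open>auto simp: hamiltonian_def D_def initial_hamiltonian_def ket_bra_def
          uniform_state_def\<close>)
    show "has_mat_derivative (2 ^ n) (\<lambda>\<beta>. complex_of_real (u \<beta>) \<cdot>\<^sub>m D)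
        (complex_of_real (u' \<beta>) \<cdot>\<^sub>m D) (at \<beta> within {0..1})"
      using has_field_derivative_at_within[OF du[OF \<beta>]] D
      by (rule has_mat_derivative_affine[where B = "0\<^sub>m (2 ^ n) (2 ^ n)"]) (use D in auto)
    show "mat_op_norm (complex_of_real (u \<beta>) \<cdot>\<^sub>m D) / gap n E (z \<beta>) ^ 2 \<le> c * K"
      using ratio[OF \<beta>] by simp
  next
    show "\<exists>\<beta>\<in>{0..1}. c * K = mat_op_norm (complex_of_real (u \<beta>) \<cdot>\<^sub>m D) / gap n E (z \<beta>) ^ 2"
      using ratio[of 0] by (intro bexI[of _ 0]) auto
  qed (use I in \<open>auto simp: T_def f_def[abs_def]\<close>)

  have T0: "0 \<le> T" using c0 K I0 \<epsilon> by (simp add: T_def)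
  have m: "1 \<le> real m" by (rule m_ge1)
  have m3: "real m \<le> real m ^ 3" using m by (simp add: self_le_power)
  have n1: "1 \<le> real n" using n by simp
  have m3n: "real m \<le> real m ^ 3 * real n"
    using mult_mono[OF m3 n1] by simp
  have "2 * (c * K) + I \<le> c * (2 * real m + 13 * (real m)\<^sup>2 * R * (2 * (3 * B + real n)))"
    using I_le mult_left_mono[OF K(2) c0] by (simp add: algebra_simps)
  also have "\<dots> \<le> c * ((2 + 156 * B * (3 * B + 1)) * (real m ^ 3 * real n))"
  proof (rule mult_left_mono[OF _ c0])
    have "3 * B + real n \<le> (3 * B + 1) * real n"
      using mult_left_mono[OF n1, of "3 * B"] B by (simp add: distrib_right)
    then have "156 * B * real m ^ 3 * (3 * B + real n)
        \<le> 156 * B * real m ^ 3 * ((3 * B + 1) * real n)"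
      using B by (intro mult_left_mono) auto
    moreover have "13 * (real m)\<^sup>2 * R * (2 * (3 * B + real n))
        = 156 * B * real m ^ 3 * (3 * B + real n)"
      by (simp add: R_def power2_eq_square power3_eq_cube)
    ultimately show "2 * real m + 13 * (real m)\<^sup>2 * R * (2 * (3 * B + real n)) \<le>
        (2 + 156 * B * (3 * B + 1)) * (real m ^ 3 * real n)"
      using m3n by (simp add: algebra_simps)
  qed
  also have "\<dots> \<le>
      R\<^sup>2 * pi / sqrt (p 0) * ((2 + 156 * B * (3 * B + 1)) * (real m ^ 3 * real n))"
    using c_le B by (intro mult_right_mono) auto
  finally have "T \<le>
      R\<^sup>2 * pi / sqrt (p 0) * ((2 + 156 * B * (3 * B + 1)) * (real m ^ 3 * real n)) / \<epsilon>"
    using c0 \<epsilon> unfolding T_def by (intro divide_right_mono) auto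
  also have "\<dots> = time_factor B \<epsilon> * real m ^ 5 * real n * (1 / sqrt (p 0))"
  proof -
    have "real m ^ 5 = (real m)\<^sup>2 * real m ^ 3" by (simp flip: power_add)
    then show ?thesis by (simp add: time_factor_def R_def power_mult_distrib mult_ac)
  qed
  also have "1 / sqrt (p 0) = sqrt (2 ^ n / real (level_count n E 0))"
    by (simp add: p_def level_density_def real_sqrt_divide)
  finally show ?thesis using schedule time T0 by blast
qed

text \<open>Comparing the minimum with the value 1 at 0 gives \<open>z_star \<le> 2\<close>, and
  \<open>n\<^sub>0 * Z\<^sub>2 \<le> 1\<close> bounds the width by
  \<open>sqrt (4 / \<delta>)\<close>. The upper bound is independent of \<open>n\<close> and serves
  as \<open>B\<close>.\<close>

lemma stopping_point:
  assumes E: "\<And>s. s < 2 ^ n \<Longrightarrow> E s \<le> m"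
    and ground: "0 < level_count n E 0" "level_count n E 0 < 2 ^ n"
    and \<delta>: "0 < \<delta>"
    and z_star: "is_arg_min (gap n E) (\<lambda>z. 0 \<le> z) z_star"
  shows "0 < z_star + stopping_width n m E \<delta>"
    and "z_star + stopping_width n m E \<delta> \<le> 2 + 2 / sqrt \<delta>"
proof -
  define A where "A = positive_levels n m E"
  define p where "p = level_density n E"
  interpret level_weights A p m
    unfolding A_def p_def using E ground by (rule level_weights_instance)
  have gap: "gap n E x = g x" if "0 \<le> x" for x
    unfolding A_def p_def using E ground that by (rule gap_eq)
  have zs: "0 \<le> z_star" "\<not> gap n E 0 < gap n E z_star"
    using z_star by (auto simp: is_arg_min_def)
  then have "g z_star \<le> 1" using gap g_at_zero by simp
  then have zs2: "z_star \<le> 2" using g_le_one_imp_le_2 zs(1) by blast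
  define Z2 where "Z2 = Z_moment n m E 2"
  have Z2: "Z2 = (\<Sum>e\<in>A. p e / real e ^ 2)"
    using sum_positive_levels[of n E "\<lambda>e. 1 / real e ^ 2" m]
    by (simp add: Z2_def Z_moment_def A_def p_def)
  have "0 < Z2"
    unfolding Z2 using finite_A A_nonempty p_pos A_ge1 by (intro sum_pos divide_pos_pos) force+
  moreover have "Z2 \<le> 1"
  proof -
    have "Z2 \<le> sum p A"
      unfolding Z2
    proof (rule sum_mono)
      fix e assume "e \<in> A"
      then show "p e / real e ^ 2 \<le> p e"
        using p_pos[of e] divide_left_mono[OF one_le_power[OF A_ge1], of e "p e" 2] A_ge1[of e]
        by simp
    qed
    then show ?thesis using p_sum_A_le by simp
  qed
  moreover have w: "stopping_width n m E \<delta> = sqrt (4 * (p 0 * Z2) / \<delta>)"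
    by (simp add: stopping_width_def p_def level_density_def Z2_def)
  ultimately have "0 < stopping_width n m E \<delta>" "p 0 * Z2 \<le> 1"
    using p0_pos p0_le \<delta> by (auto intro: mult_le_one)
  moreover have "stopping_width n m E \<delta> \<le> sqrt (4 / \<delta>)"
    unfolding w using \<open>p 0 * Z2 \<le> 1\<close> \<delta> by (intro real_sqrt_le_mono divide_right_mono) auto
  ultimately show "0 < z_star + stopping_width n m E \<delta>"
    "z_star + stopping_width n m E \<delta> \<le> 2 + 2 / sqrt \<delta>"
    using zs(1) zs2 by (simp_all add: real_sqrt_divide)
qed

theorem lemma1:
  fixes E :: "nat \<Rightarrow> nat \<Rightarrow> nat" and m :: "nat \<Rightarrow> nat" and z_star z_f :: "nat \<Rightarrow> real"
    and \<delta> \<epsilon> :: real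
  assumes cost: "\<And>n s. n \<ge> 1 \<Longrightarrow> s < 2 ^ n \<Longrightarrow> E n s \<le> m n"
    and poly: "\<exists>d. (\<lambda>n. real (m n)) \<in> O(\<lambda>n. real n ^ d)"
    and ground: "\<And>n. n \<ge> 1 \<Longrightarrow> 0 < level_count n (E n) 0 \<and> level_count n (E n) 0 < 2 ^ n"
    and delta: "0 < \<delta>" "\<delta> < 1"
    and eps: "0 < \<epsilon>"
    and z_star: "\<And>n. n \<ge> 1 \<Longrightarrow> is_arg_min (gap n (E n)) (\<lambda>z. 0 \<le> z) (z_star n)"
    and z_f: "\<And>n. n \<ge> 1 \<Longrightarrow> z_f n = z_star n + stopping_width n (m n) (E n) \<delta>"
  shows "\<exists>(z :: nat \<Rightarrow> real \<Rightarrow> real) (T :: nat \<Rightarrow> real).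
           (\<forall>n \<ge> 1. gap_schedule n (E n) (z_f n) (z n) \<and> adiabatic_time n (E n) \<epsilon> (z n) (T n)) \<and>
           (\<exists>k. T \<in> O(\<lambda>n. real n ^ k * sqrt (2 ^ n / real (level_count n (E n) 0))))"
proof -
  define S where "S n = sqrt (2 ^ n / real (level_count n (E n) 0))" for n
  define C where "C = time_factor (2 + 2 / sqrt \<delta>) \<epsilon>"
  \<comment> \<open>The implication covers \<open>n = 0\<close> vacuously, so one choice over all
    \<open>n\<close> is possible. Nonnegativity of \<open>T\<close> is kept because the O-statement
    concerns its absolute value.\<close>
  have "\<exists>z T. n \<ge> 1 \<longrightarrow> gap_schedule n (E n) (z_f n) z \<and> adiabatic_time n (E n) \<epsilon> z T \<and>
      0 \<le> T \<and> T \<le> C * real (m n) ^ 5 * real n * S n" for n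
  proof (cases "n \<ge> 1")
    case True
    note stop = stopping_point[OF cost[OF True] conjunct1[OF ground[OF True]]
        conjunct2[OF ground[OF True]] delta(1) z_star[OF True], folded z_f[OF True]]
    show ?thesis
      using adiabatic_time_bound[OF cost[OF True] conjunct1[OF ground[OF True]]
          conjunct2[OF ground[OF True]] True eps _ stop] delta
      unfolding C_def S_def by auto
  qed simp
  then obtain z T where zT: "\<And>n. n \<ge> 1 \<Longrightarrow> gap_schedule n (E n) (z_f n) (z n) \<and>
      adiabatic_time n (E n) \<epsilon> (z n) (T n) \<and> 0 \<le> T n \<and> T n \<le> C * real (m n) ^ 5 * real n * S n"
    by metis
  obtain d where d: "(\<lambda>n. real (m n)) \<in> O(\<lambda>n. real n ^ d)" using poly by blast
  have "T \<in> O(\<lambda>n. C * real (m n) ^ 5 * real n * S n)"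
    using zT by (intro bigoI[of _ 1] eventually_sequentiallyI[of 1]) fastforce
  \<comment> \<open>The product is compared factor by factor: the constant \<open>C\<close> against
    1, and each of the five powers of \<open>m\<close> against \<open>real n ^ d\<close>.\<close>
  also have "(\<lambda>n. C * real (m n) ^ 5 * real n * S n) \<in> O(\<lambda>n. 1 * (real n ^ d) ^ 5 * real n * S n)"
    by (intro landau_o.big.mult landau_o.big_power d) auto
  also have "(\<lambda>n. 1 * (real n ^ d) ^ 5 * real n * S n) = (\<lambda>n. real n ^ (d * 5 + 1) * S n)"
    by (simp add: power_mult mult_ac)
  finally show ?thesis using zT unfolding S_def by blast
qed

end
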